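(* Let $\mathcal{L}$ be a finite bounded distributive lattice, let $\ell_1,\dots,\ell_k\in\mathcal{L}$ and let $n_1,\dots,n_k$ be non-zero natural numbers. The quasi-valuation $\nu_{\mathrm{ht}}:\mathbb{C}(\mathbb{X}_{\mathcal{L}})\setminus\{0\}\to\mathbb{Z}^N$ satisfies the following properties: (1) For any maximal chain $\mathcal{C}$ of $\mathcal{L}$, $$\nu_{\mathrm{ht}}(\hat x_{\ell_1}^{n_1}\cdots\hat x_{\ell_k}^{n_k})\le\nu_{\mathcal{C},\mathrm{ht}}(\hat x_{\ell_1}^{n_1}\cdots\hat x_{\ell_k}^{n_k}),$$ and equality holds only if $\{\ell_1,\dots,\ell_k\}\subset\mathcal{C}$. (2) If the monomial $\hat x_{\ell_1}^{n_1}\cdots\hat x_{\ell_k}^{n_k}$ is standard, and $\mathcal{C}$ is a maximal chain containing $\{\ell_1,\dots,\ell_k\}$, then $$\nu_{\mathrm{ht}}(\hat x_{\ell_1}^{n_1}\cdots\hat x_{\ell_k}^{n_k})=\sum_{j=1}^kn_j\nu_{\mathrm{ht}}(\hat x_{\ell_j})=\sum_{j=1}^kn_j\nu_{\mathcal{C},\mathrm{ht}}(\hat x_{\ell_j}).$$ (3) If the monomial $\hat x_{\ell_1}^{n_1}\cdots\hat x_{\ell_k}^{n_k}$ is not standard, then $$\nu_{\mathrm{ht}}(\hat x_{\ell_1}^{n_1}\cdots\hat x_{\ell_k}^{n_k})>\sum_{j=1}^kn_j\nu_{\mathrm{ht}}(\hat x_{\ell_j}).$$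
   Context: Lattice notation: $\mathbb{O}$ is the minimal element of $\mathcal{L}$; all maximal chains of $\mathcal{L}$ have the same length $N$ (number of steps); $C(\mathcal{L})$ is the set of maximal chains, and a maximal chain is written $\mathcal{C}=\{\mathbb{O}=c_0<c_1<\dots<c_N\}$. Hibi variety: $\mathbb{X}_{\mathcal{L}}\subset\mathbb{P}(\mathbb{C}^{|\mathcal{L}|})$ is the irreducible projective variety with homogeneous coordinate ring $R(\mathcal{L})=\mathbb{C}[X_\ell\mid\ell\in\mathcal{L}]/\langle X_{\ell}X_{\ell'}-X_{\ell\wedge\ell'}X_{\ell\vee\ell'}\mid\ell,\ell'\text{ non-comparable}\rangle$; $x_\ell$ is the class of $X_\ell$, and $\hat x_\ell=x_\ell/x_{\mathbb{O}}\in\mathbb{C}(\mathbb{X}_{\mathcal{L}})$ (so $\hat x_{\mathbb{O}}=1$). For each maximal chain, $\hat x_{c_1},\dots,\hat x_{c_N}$ are algebraically independent and $\mathbb{C}(\mathbb{X}_{\mathcal{L}})=\mathbb{C}(\hat x_{c_1},\dots,\hat x_{c_N})$. A monomial in the $\hat x_{\ell_j}$ (all exponents nonzero) is standard if its indices can be ordered so that $\ell_1\ge\dots\ge\ell_k$, i.e. they are pairwise comparable. Valuations: $\mathbb{Z}^N$ has standard basis $\mathbf{e}_1,\dots,\mathbf{e}_N$ and carries the reverse lexicographic total order: $\mathbf{a}>\mathbf{b}$ iff the last nonzero coordinate of $\mathbf{a}-\mathbf{b}$ is positive. For a maximal chain $\mathcal{C}$, the valuation $\nu_{\mathcal{C},\mathrm{ht}}$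 on $\mathbb{C}(\mathbb{X}_{\mathcal{L}})$ is given on monomials by $\nu_{\mathcal{C},\mathrm{ht}}(\hat x_{c_1}^{a_1}\cdots\hat x_{c_N}^{a_N})=\sum_ja_j\mathbf{e}_j$, on nonzero polynomials in $\hat x_{c_1},\dots,\hat x_{c_N}$ as the minimum over the monomials occurring, and on fractions by $\nu(f/g)=\nu(f)-\nu(g)$. Finally $\nu_{\mathrm{ht}}(h)=\min\{\nu_{\mathcal{C},\mathrm{ht}}(h)\mid\mathcal{C}\in C(\mathcal{L})\}$, a quasi-valuation (i.e. $\nu(f+g)\ge\min\{\nu(f),\nu(g)\}$, $\nu(cf)=\nu(f)$ for $c\in\mathbb{C}^*$, $\nu(fg)\ge\nu(f)+\nu(g)$).
   Formalization: In (1), "equality holds only if {ℓ_1,…,ℓ_k} ⊂ C" is proved only for standard monomials; it fails for every non-standard monomial, e.g. x̂_a x̂_b = x̂_1 in the Boolean lattice {0,a,b,1}, where both maximal chains attain equality but neither contains {a,b}. *)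

theory Defs
  imports Complex_Main "HOL-Library.Poly_Mapping" "HOL-Library.Dual_Ordered_Lattice"
    "HOL-Library.Countable" "HOL-Library.Cardinality"
    "HOL-Computational_Algebra.Fraction_Field"
begin

section \<open>The Hibi ring\<close>

text \<open>
  A finite bounded distributive lattice is a type of sort
  \<open>{finite, distrib_lattice, bounded_lattice}\<close>. Polynomials over the complex numbers with
  variables indexed by \<open>'v\<close> are finitely supported functions from exponent vectors to
  coefficients, with the convolution product.
\<close>

type_synonym 'v cpoly = "('v \<Rightarrow>\<^sub>0 nat) \<Rightarrow>\<^sub>0 complex"

definition pmonom :: "('v \<Rightarrow>\<^sub>0 nat) \<Rightarrow> 'v cpoly"
  where "pmonom m = Poly_Mapping.single m 1"

definition pvar :: "'v \<Rightarrow> 'v cpoly"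
  where "pvar v = pmonom (Poly_Mapping.single v 1)"

definition pconst :: "complex \<Rightarrow> 'v cpoly"
  where "pconst c = Poly_Mapping.single 0 c"

definition homogeneous_poly :: "nat \<Rightarrow> 'v cpoly \<Rightarrow> bool"
  where "homogeneous_poly d p \<longleftrightarrow>
    (\<forall>m\<in>Poly_Mapping.keys p. (\<Sum>v\<in>Poly_Mapping.keys m. Poly_Mapping.lookup m v) = d)"

text \<open>The span over the polynomial ring itself is the generated ideal.\<close>

definition hibi_ideal :: "'a::{finite, distrib_lattice, bounded_lattice} cpoly set"
  where "hibi_ideal = module.span (*)
    {pvar a * pvar b - pvar (inf a b) * pvar (sup a b) | a b. \<not> a \<le> b \<and> \<not> b \<le> a}"

lemma module_times: "module ((*) :: 'r::comm_ring_1 \<Rightarrow> 'r \<Rightarrow> 'r)"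
  by standard (simp_all add: algebra_simps)

lemma hibi_ideal_zero: "0 \<in> hibi_ideal"
  unfolding hibi_ideal_def by (rule module.span_zero[OF module_times])

lemma hibi_ideal_add: "p \<in> hibi_ideal \<Longrightarrow> q \<in> hibi_ideal \<Longrightarrow> p + q \<in> hibi_ideal"
  unfolding hibi_ideal_def by (rule module.span_add[OF module_times])

lemma hibi_ideal_diff: "p \<in> hibi_ideal \<Longrightarrow> q \<in> hibi_ideal \<Longrightarrow> p - q \<in> hibi_ideal"
  unfolding hibi_ideal_def by (rule module.span_diff[OF module_times])

lemma hibi_ideal_scale: "p \<in> hibi_ideal \<Longrightarrow> r * p \<in> hibi_ideal"
  unfolding hibi_ideal_def by (rule module.span_scale[OF module_times])

lemma hibi_ideal_base:
  "\<not> a \<le> b \<Longrightarrow> \<not> b \<le> a \<Longrightarrow>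
    pvar a * pvar b - pvar (inf a b) * pvar (sup a b) \<in> hibi_ideal"
  unfolding hibi_ideal_def by (rule module.span_base[OF module_times]) blast

subsection \<open>The Hibi ideal is prime\<close>

text \<open>
  The Hibi ideal is the kernel of the toric map sending the variable of \<open>a\<close> to the product of
  the indeterminates of the join prime elements below \<open>a\<close> (\<open>bot\<close> counts as join prime here and
  records the degree).
\<close>

definition jprime :: "'a::{finite, distrib_lattice, bounded_lattice} \<Rightarrow> bool"
  where "jprime p \<longleftrightarrow> (\<forall>a b. p \<le> sup a b \<longrightarrow> p \<le> a \<or> p \<le> b)"

lemma jprime_bot: "jprime bot"
  by (simp add: jprime_def)

lemma jprime_sup_iff: "jprime p \<Longrightarrow> p \<le> sup a b \<longleftrightarrow> p \<le> a \<or> p \<le> b"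
  unfolding jprime_def using le_supI1 le_supI2 by blast

lemma jprime_le:
  fixes a b :: "'a::{finite, distrib_lattice, bounded_lattice}"
  assumes "\<And>p. jprime p \<Longrightarrow> p \<le> a \<Longrightarrow> p \<le> b"
  shows "a \<le> b"
proof (rule ccontr)
  assume "\<not> a \<le> b"
  then have "{p. p \<le> a \<and> \<not> p \<le> b} \<noteq> {}" by auto
  then obtain p where p: "p \<le> a" "\<not> p \<le> b"
    and min: "\<And>q. q \<le> a \<Longrightarrow> \<not> q \<le> b \<Longrightarrow> q \<le> p \<Longrightarrow> q = p"
    using finite_has_minimal[of "{p. p \<le> a \<and> \<not> p \<le> b}"] by auto
  have "jprime p"
    unfolding jprime_def
  proof (intro allI impI, rule ccontr)
    fix x y assume le: "p \<le> sup x y" and n: "\<not> (p \<le> x \<or> p \<le> y)"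
    have eq: "p = sup (inf p x) (inf p y)"
      using le by (metis inf.absorb1 inf_sup_distrib1)
    have "inf p x \<le> b"
      using min[of "inf p x"] n p(1) by (metis inf.cobounded1 inf.cobounded2 order.trans)
    moreover have "inf p y \<le> b"
      using min[of "inf p y"] n p(1) by (metis inf.cobounded1 inf.cobounded2 order.trans)
    ultimately have "p \<le> b" using eq by (metis sup.bounded_iff)
    with p show False by simp
  qed
  with assms p show False by blast
qed

definition jweight :: "('a::{finite, distrib_lattice, bounded_lattice} \<Rightarrow>\<^sub>0 nat) \<Rightarrow> nat \<Rightarrow>\<^sub>0 nat"
  where "jweight m =
    (\<Sum>p\<in>{p. jprime p}. Poly_Mapping.single (to_nat p) (\<Sum>a\<in>{a. p \<le> a}. Poly_Mapping.lookup m a))"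

lemma lookup_jweight:
  assumes "jprime p"
  shows "Poly_Mapping.lookup (jweight m) (to_nat p) = (\<Sum>a\<in>{a. p \<le> a}. Poly_Mapping.lookup m a)"
proof -
  have "Poly_Mapping.lookup (jweight m) (to_nat p) =
     (\<Sum>q\<in>{p. jprime p}. if q = p then (\<Sum>a\<in>{a. q \<le> a}. Poly_Mapping.lookup m a) else 0)"
    unfolding jweight_def by (auto simp: lookup_sum lookup_single when_def intro!: sum.cong)
  then show ?thesis using assms by simp
qed

lemma jweight_plus: "jweight (m + n) = jweight m + jweight n"
  by (simp add: jweight_def lookup_add sum.distrib single_add)

lemma jweight_zero: "jweight 0 = 0"
  by (simp add: jweight_def)

lemma jweight_relation:
  fixes a b :: "'a::{finite, distrib_lattice, bounded_lattice}"
  shows "jweight (Poly_Mapping.single a 1 + Poly_Mapping.single b 1) =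
    jweight (Poly_Mapping.single (inf a b) 1 + Poly_Mapping.single (sup a b) 1)"
  unfolding jweight_def
proof (rule sum.cong[OF refl])
  fix p :: 'a assume "p \<in> {p. jprime p}"
  then have p: "jprime p" by simp
  have s: "(\<Sum>x\<in>{x. p \<le> x}. Poly_Mapping.lookup (Poly_Mapping.single c (1::nat)) x) = (if p \<le> c then 1 else 0)"
    for c
    by (simp add: lookup_single when_def)
  have "(\<Sum>x\<in>{x. p \<le> x}. Poly_Mapping.lookup (Poly_Mapping.single a 1 + Poly_Mapping.single b (1::nat)) x) =
    (\<Sum>x\<in>{x. p \<le> x}. Poly_Mapping.lookup (Poly_Mapping.single (inf a b) 1 + Poly_Mapping.single (sup a b) (1::nat)) x)"
    unfolding lookup_add sum.distrib s using jprime_sup_iff[OF p, of a b] by auto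
  then show "Poly_Mapping.single (to_nat p) (\<Sum>x\<in>{x. p \<le> x}. Poly_Mapping.lookup (Poly_Mapping.single a 1 + Poly_Mapping.single b (1::nat)) x) =
    Poly_Mapping.single (to_nat p) (\<Sum>x\<in>{x. p \<le> x}. Poly_Mapping.lookup (Poly_Mapping.single (inf a b) 1 + Poly_Mapping.single (sup a b) (1::nat)) x)"
    by simp
qed

definition push :: "('k \<Rightarrow> 'l) \<Rightarrow> ('k \<Rightarrow>\<^sub>0 complex) \<Rightarrow> 'l \<Rightarrow>\<^sub>0 complex"
  where "push f p = (\<Sum>m\<in>Poly_Mapping.keys p. Poly_Mapping.single (f m) (Poly_Mapping.lookup p m))"

lemma push_superset:
  assumes "finite S" "Poly_Mapping.keys p \<subseteq> S"
  shows "push f p = (\<Sum>m\<in>S. Poly_Mapping.single (f m) (Poly_Mapping.lookup p m))"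
  unfolding push_def
  by (rule sum.mono_neutral_left) (use assms in \<open>auto simp: in_keys_iff\<close>)

lemma push_zero: "push f 0 = 0"
  by (simp add: push_def)

lemma push_plus: "push f (p + q) = push f p + push f q"
proof -
  let ?S = "Poly_Mapping.keys p \<union> Poly_Mapping.keys q"
  have "push f (p + q) = (\<Sum>m\<in>?S. Poly_Mapping.single (f m) (Poly_Mapping.lookup (p + q) m))"
    by (rule push_superset) (use keys_add[of p q] in auto)
  also have "\<dots> = push f p + push f q"
    by (simp add: push_superset[of ?S p] push_superset[of ?S q] lookup_add single_add sum.distrib)
  finally show ?thesis .
qed

lemma push_single: "push f (Poly_Mapping.single m c) = Poly_Mapping.single (f m) c"
  by (cases "c = 0") (auto simp: push_def)

lemma push_minus: "push f (p - q) = push f p - push f q"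
  by (metis add_diff_cancel_right' diff_add_cancel push_plus)

lemma poly_mapping_add_induct:
  fixes p :: "'k \<Rightarrow>\<^sub>0 complex"
  assumes "P 0" "\<And>m c. P (Poly_Mapping.single m c)" "\<And>p q. P p \<Longrightarrow> P q \<Longrightarrow> P (p + q)"
  shows "P p"
proof -
  have *: "P (\<Sum>m\<in>S. Poly_Mapping.single m (Poly_Mapping.lookup p m))" if "finite S" for S
    using that by induction (simp_all add: assms)
  moreover have "(\<Sum>m\<in>Poly_Mapping.keys p. Poly_Mapping.single m (Poly_Mapping.lookup p m)) = p"
    by (intro poly_mapping_eqI) (simp add: lookup_sum lookup_single when_def not_in_keys_iff_lookup_eq_zero)
  ultimately show ?thesis using *[OF finite_keys[of p]] by simp
qed

lemma push_comp: "push g (push f p) = push (\<lambda>m. g (f m)) p"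
  by (induction p rule: poly_mapping_add_induct) (auto simp: push_zero push_single push_plus)

lemma push_times:
  assumes "\<And>m n. f (m + n) = f m + f n"
  shows "push f (p * q) = push f p * push f (q :: 'k::comm_monoid_add \<Rightarrow>\<^sub>0 complex)"
proof (induction p rule: poly_mapping_add_induct)
  case 1 then show ?case by (simp add: push_zero)
next
  case (2 m c)
  show ?case
    by (induction q rule: poly_mapping_add_induct)
      (auto simp: push_zero push_single push_plus mult_single assms distrib_left)
next
  case (3 p q) then show ?case by (simp add: push_plus distrib_right)
qed

lemma pmonom_plus: "pmonom (m + n) = pmonom m * pmonom n"
  by (simp add: pmonom_def mult_single)

lemma hibi_ideal_push:
  assumes "p \<in> hibi_ideal"
  shows "push jweight p = 0"
proof -
  have sub: "module.subspace (*) {p. push jweight p = 0}"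
    by (auto simp: module.subspace_def[OF module_times] push_zero push_plus
        push_times[OF jweight_plus])
  have "push jweight (pvar a * pvar b - pvar (inf a b) * pvar (sup a b)) = 0" for a b :: 'a
    using jweight_relation[of a b]
    by (simp add: push_minus push_single pvar_def pmonom_def mult_single)
  then have "{pvar a * pvar b - pvar (inf a b) * pvar (sup a b) | a b :: 'a. \<not> a \<le> b \<and> \<not> b \<le> a}
      \<subseteq> {p. push jweight p = 0}"
    by blast
  from module.span_minimal[OF module_times this sub] assms show ?thesis
    unfolding hibi_ideal_def by blast
qed

definition std_exponent :: "('a::order \<Rightarrow>\<^sub>0 nat) \<Rightarrow> bool"
  where "std_exponent m \<longleftrightarrow> (\<forall>a\<in>Poly_Mapping.keys m. \<forall>b\<in>Poly_Mapping.keys m. a \<le> b \<or> b \<le> a)"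

lemma split_key:
  fixes m :: "'k \<Rightarrow>\<^sub>0 nat"
  assumes "a \<in> Poly_Mapping.keys m"
  obtains m' where "m = m' + Poly_Mapping.single a 1"
proof
  have "Poly_Mapping.lookup m a > 0" using assms by (simp add: in_keys_iff)
  then show "m = (m - Poly_Mapping.single a 1) + Poly_Mapping.single a 1"
    by (intro poly_mapping_eqI) (auto simp: lookup_add lookup_minus lookup_single when_def)
qed

definition jrank :: "'a::{finite, distrib_lattice, bounded_lattice} \<Rightarrow> nat"
  where "jrank a = card {p. jprime p \<and> p \<le> a}"

lemma jrank_modular: "jrank (inf a b) + jrank (sup a b) = jrank a + jrank b"
proof -
  have "{p. jprime p \<and> p \<le> sup a b} = {p. jprime p \<and> p \<le> a} \<union> {p. jprime p \<and> p \<le> b}"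
    using jprime_sup_iff by blast
  moreover have "{p. jprime p \<and> p \<le> inf a b} = {p. jprime p \<and> p \<le> a} \<inter> {p. jprime p \<and> p \<le> b}"
    by auto
  ultimately show ?thesis
    unfolding jrank_def by (simp add: card_Un_Int[of "{p. jprime p \<and> p \<le> a}"])
qed

lemma jrank_strict:
  assumes "a < b"
  shows "jrank a < jrank b"
  unfolding jrank_def
proof (rule psubset_card_mono)
  have "{p. jprime p \<and> p \<le> a} \<subseteq> {p. jprime p \<and> p \<le> b}" using assms by auto
  moreover have "\<not> {p. jprime p \<and> p \<le> b} \<subseteq> {p. jprime p \<and> p \<le> a}"
    using jprime_le[of b a] assms by (auto dest: leD)
  ultimately show "{p. jprime p \<and> p \<le> a} \<subset> {p. jprime p \<and> p \<le> b}" by auto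
qed simp

lemma jrank_le: "jrank a \<le> CARD('a)" for a :: "'a::{finite, distrib_lattice, bounded_lattice}"
  unfolding jrank_def by (rule card_mono) auto

definition straighten_measure :: "('a::{finite, distrib_lattice, bounded_lattice} \<Rightarrow>\<^sub>0 nat) \<Rightarrow> nat"
  where "straighten_measure m = (\<Sum>a\<in>UNIV. Poly_Mapping.lookup m a * (CARD('a)^2 - jrank a ^ 2))"

lemma straighten_measure_plus:
  "straighten_measure (m + n) = straighten_measure m + straighten_measure n"
  by (simp add: straighten_measure_def lookup_add sum.distrib distrib_right)

lemma straighten_measure_single:
  "straighten_measure (Poly_Mapping.single a 1) = CARD('a)^2 - jrank a ^ 2"
  for a :: "'a::{finite, distrib_lattice, bounded_lattice}"
proof -
  have "straighten_measure (Poly_Mapping.single a 1) =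
      (\<Sum>b\<in>UNIV. if b = a then CARD('a)^2 - jrank b ^ 2 else 0)"
    unfolding straighten_measure_def
    by (rule sum.cong) (auto simp: lookup_single when_def)
  then show ?thesis by simp
qed

lemma straighten_step:
  fixes a b :: "'a::{finite, distrib_lattice, bounded_lattice}"
  assumes "\<not> a \<le> b" "\<not> b \<le> a"
  shows "straighten_measure (Poly_Mapping.single (inf a b) 1 + Poly_Mapping.single (sup a b) 1) <
    straighten_measure (Poly_Mapping.single a 1 + Poly_Mapping.single b 1)"
proof -
  let ?K = "int CARD('a)" and ?s = "int (jrank (inf a b))" and ?t = "int (jrank (sup a b))"
  let ?x = "int (jrank a)" and ?y = "int (jrank b)"
  have "inf a b < a" "inf a b < b" using assms by (metis inf.cobounded1 inf.cobounded2 order.not_eq_order_implies_strict)+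
  then have lt: "?s < ?x" "?s < ?y" using jrank_strict by auto
  have "?s + ?t = ?x + ?y" using jrank_modular[of a b] by linarith
  then have t: "?t = ?x + ?y - ?s" by simp
  have "(?x - ?s) * (?y - ?s) > 0" using lt by simp
  then have *: "?x^2 + ?y^2 < ?s^2 + ?t^2" unfolding t by (simp add: power2_eq_square algebra_simps)
  have i: "int (CARD('a)^2 - jrank c ^ 2) = ?K^2 - int (jrank c)^2" for c :: 'a
    using jrank_le[of c] by (simp add: of_nat_diff power_mono)
  show ?thesis
    unfolding straighten_measure_plus straighten_measure_single
    unfolding of_nat_less_iff[where 'a=int, symmetric] of_nat_add i
    using * by simp
qed

lemma straighten:
  fixes u :: "'a::{finite, distrib_lattice, bounded_lattice} \<Rightarrow>\<^sub>0 nat"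
  shows "\<exists>v. std_exponent v \<and> jweight v = jweight u \<and> pmonom u - pmonom v \<in> hibi_ideal"
proof (induction u rule: measure_induct_rule[where f = straighten_measure])
  case (less u)
  show ?case
  proof (cases "std_exponent u")
    case True
    then show ?thesis using hibi_ideal_zero by (intro exI[of _ u]) auto
  next
    case False
    then obtain a b where ab: "a \<in> Poly_Mapping.keys u" "b \<in> Poly_Mapping.keys u"
      and nc: "\<not> a \<le> b" "\<not> b \<le> a"
      unfolding std_exponent_def by auto
    obtain u1 where u1: "u = u1 + Poly_Mapping.single a 1" using split_key[OF ab(1)] .
    have "b \<noteq> a" using nc by auto
    then have "b \<in> Poly_Mapping.keys u1"
      using ab(2) unfolding u1 by (auto simp: in_keys_iff lookup_add lookup_single when_def)
    from split_key[OF this] obtain u2 where u2: "u1 = u2 + Poly_Mapping.single b 1" .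
    let ?ab = "Poly_Mapping.single a 1 + Poly_Mapping.single b (1::nat)"
    let ?is = "Poly_Mapping.single (inf a b) 1 + Poly_Mapping.single (sup a b) (1::nat)"
    have u: "u = u2 + ?ab" unfolding u1 u2 by (simp add: algebra_simps)
    have "straighten_measure (u2 + ?is) < straighten_measure u"
      unfolding u straighten_measure_plus[of u2] using straighten_step[OF nc] by simp
    from less.IH[OF this] obtain v where v: "std_exponent v" "jweight v = jweight (u2 + ?is)"
      "pmonom (u2 + ?is) - pmonom v \<in> hibi_ideal" by auto
    have "pmonom u - pmonom (u2 + ?is) =
        pmonom u2 * (pvar a * pvar b - pvar (inf a b) * pvar (sup a b))"
      unfolding u pmonom_plus pvar_def by (simp add: algebra_simps)
    also have "\<dots> \<in> hibi_ideal"
      by (intro hibi_ideal_scale hibi_ideal_base nc)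
    finally have "pmonom u - pmonom (u2 + ?is) \<in> hibi_ideal" .
    from hibi_ideal_add[OF this v(3)] have "pmonom u - pmonom v \<in> hibi_ideal" by simp
    moreover have "jweight v = jweight u"
      unfolding v(2) u jweight_plus[of u2] jweight_relation[of a b] ..
    ultimately show ?thesis using v(1) by blast
  qed
qed

lemma finite_chain_top:
  fixes S :: "'a::order set"
  assumes "finite S" "S \<noteq> {}" "\<forall>a\<in>S. \<forall>b\<in>S. a \<le> b \<or> b \<le> a"
  obtains t where "t \<in> S" "\<And>a. a \<in> S \<Longrightarrow> a \<le> t"
proof -
  obtain t where t: "t \<in> S" "\<forall>a\<in>S. t \<le> a \<longrightarrow> t = a"
    using finite_has_maximal[OF assms(1,2)] by blast
  then have "a \<le> t" if "a \<in> S" for a using assms(3) that by fastforce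
  with t(1) that show ?thesis by blast
qed

lemma jweight_pos_iff:
  assumes "jprime p" "t \<in> Poly_Mapping.keys u" "\<And>a. a \<in> Poly_Mapping.keys u \<Longrightarrow> a \<le> t"
  shows "Poly_Mapping.lookup (jweight u) (to_nat p) > 0 \<longleftrightarrow> p \<le> t"
proof -
  have "Poly_Mapping.lookup (jweight u) (to_nat p) > 0 \<longleftrightarrow>
      (\<exists>a. p \<le> a \<and> a \<in> Poly_Mapping.keys u)"
    unfolding lookup_jweight[OF assms(1)] zero_less_iff_neq_zero by (auto simp: in_keys_iff)
  then show ?thesis using assms(2,3) order.trans by blast
qed

lemma jweight_eq_zero:
  assumes "jweight v = 0"
  shows "v = 0"
proof -
  have "(\<Sum>a\<in>UNIV. Poly_Mapping.lookup v a) = 0"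
    using lookup_jweight[OF jprime_bot, of v] assms by simp
  then show ?thesis by (intro poly_mapping_eqI) simp
qed

lemma std_exponent_unique:
  fixes u v :: "'a::{finite, distrib_lattice, bounded_lattice} \<Rightarrow>\<^sub>0 nat"
  assumes "std_exponent u" "std_exponent v" "jweight u = jweight v"
  shows "u = v"
  using assms
proof (induction "\<Sum>a\<in>UNIV. Poly_Mapping.lookup u a" arbitrary: u v rule: less_induct)
  case less
  show ?case
  proof (cases "u = 0")
    case True
    then show ?thesis using less.prems(3) jweight_eq_zero[of v] by (simp add: jweight_zero)
  next
    case False
    then have "v \<noteq> 0" using less.prems(3) jweight_eq_zero[of u] by (auto simp: jweight_zero)
    have "Poly_Mapping.keys u \<noteq> {}" using False by simp
    from finite_chain_top[OF finite_keys this] less.prems(1) obtain t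
      where t: "t \<in> Poly_Mapping.keys u" "\<And>a. a \<in> Poly_Mapping.keys u \<Longrightarrow> a \<le> t"
      unfolding std_exponent_def by metis
    have "Poly_Mapping.keys v \<noteq> {}" using \<open>v \<noteq> 0\<close> by simp
    from finite_chain_top[OF finite_keys this] less.prems(2) obtain t'
      where t': "t' \<in> Poly_Mapping.keys v" "\<And>a. a \<in> Poly_Mapping.keys v \<Longrightarrow> a \<le> t'"
      unfolding std_exponent_def by metis
    have iff: "p \<le> t \<longleftrightarrow> p \<le> t'" if "jprime p" for p
      using jweight_pos_iff[OF that t] jweight_pos_iff[OF that t'] less.prems(3) by simp
    have tt: "t' = t" by (rule antisym; rule jprime_le) (simp_all add: iff)
    obtain u1 where u1: "u = u1 + Poly_Mapping.single t 1" using split_key[OF t(1)] .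
    obtain v1 where v1: "v = v1 + Poly_Mapping.single t 1" using split_key[OF t'(1)] unfolding tt .
    have "std_exponent u1" "std_exponent v1"
      using less.prems(1,2) unfolding u1 v1 std_exponent_def
      by (auto simp: in_keys_iff lookup_add)
    moreover have "jweight u1 = jweight v1"
      using less.prems(3) unfolding u1 v1 jweight_plus by simp
    moreover have "(\<Sum>a\<in>UNIV. Poly_Mapping.lookup u1 a) < (\<Sum>a\<in>UNIV. Poly_Mapping.lookup u a)"
      unfolding u1 by (simp add: lookup_add sum.distrib lookup_single when_def)
    ultimately have "u1 = v1" using less.hyps by blast
    then show ?thesis by (simp add: u1 v1)
  qed
qed

lemma pmonom_congruent:
  assumes "jweight u = jweight v"
  shows "pmonom u - pmonom v \<in> hibi_ideal"
proof -
  obtain u' where u': "std_exponent u'" "jweight u' = jweight u" "pmonom u - pmonom u' \<in> hibi_ideal"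
    using straighten by blast
  obtain v' where v': "std_exponent v'" "jweight v' = jweight v" "pmonom v - pmonom v' \<in> hibi_ideal"
    using straighten by blast
  have "u' = v'" using std_exponent_unique[OF u'(1) v'(1)] u'(2) v'(2) assms by simp
  then show ?thesis using hibi_ideal_diff[OF u'(3) v'(3)] by simp
qed

lemma push_zero_hibi_ideal:
  fixes p :: "'a::{finite, distrib_lattice, bounded_lattice} cpoly"
  assumes "push jweight p = 0"
  shows "p \<in> hibi_ideal"
proof -
  define r where "r = (\<lambda>k. SOME u :: 'a \<Rightarrow>\<^sub>0 nat. jweight u = k)"
  have r: "jweight (r (jweight m)) = jweight m" for m :: "'a \<Rightarrow>\<^sub>0 nat"
    unfolding r_def by (rule someI[of "\<lambda>u. jweight u = jweight m" m]) simp
  have *: "q - push (\<lambda>m. r (jweight m)) q \<in> hibi_ideal" for q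
  proof (induction q rule: poly_mapping_add_induct)
    case 1 show ?case by (simp add: push_zero hibi_ideal_zero)
  next
    case (2 m c)
    have "pmonom m - pmonom (r (jweight m)) \<in> hibi_ideal"
      by (rule pmonom_congruent) (simp add: r)
    then have "Poly_Mapping.single 0 c * (pmonom m - pmonom (r (jweight m))) \<in> hibi_ideal"
      by (rule hibi_ideal_scale)
    then show ?case by (simp add: push_single right_diff_distrib pmonom_def mult_single)
  next
    case (3 p q)
    from hibi_ideal_add[OF this] show ?case by (simp add: push_plus algebra_simps)
  qed
  have "push (\<lambda>m. r (jweight m)) p = 0"
    unfolding push_comp[of r jweight p, symmetric] assms push_zero ..
  with *[of p] show ?thesis by simp
qed

lemma hibi_ideal_iff: "p \<in> hibi_ideal \<longleftrightarrow> push jweight p = 0"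
  using hibi_ideal_push push_zero_hibi_ideal by blast

lemma hibi_ideal_prime: "p * q \<in> hibi_ideal \<Longrightarrow> p \<in> hibi_ideal \<or> q \<in> hibi_ideal"
  by (simp add: hibi_ideal_iff push_times[OF jweight_plus])

lemma one_notin_hibi_ideal: "(1 :: 'a::{finite, distrib_lattice, bounded_lattice} cpoly) \<notin> hibi_ideal"
  using push_single[of "jweight :: ('a \<Rightarrow>\<^sub>0 nat) \<Rightarrow> _" 0 1] by (simp add: hibi_ideal_iff jweight_zero)

subsection \<open>The quotient ring\<close>

definition hibi_rel :: "'a::{finite, distrib_lattice, bounded_lattice} cpoly \<Rightarrow> 'a cpoly \<Rightarrow> bool"
  where "hibi_rel p q \<longleftrightarrow> p - q \<in> hibi_ideal"

lemma hibi_rel_push: "hibi_rel p q \<longleftrightarrow> push jweight p = push jweight q"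
  by (simp add: hibi_rel_def hibi_ideal_iff push_minus)

quotient_type (overloaded) 'a hibi_ring = "'a::{finite, distrib_lattice, bounded_lattice} cpoly" / hibi_rel
  by (rule equivpI) (auto simp: reflp_def symp_def transp_def hibi_rel_push)

instantiation hibi_ring :: ("{finite, distrib_lattice, bounded_lattice}") idom
begin

lift_definition zero_hibi_ring :: "'a hibi_ring" is 0 .
lift_definition one_hibi_ring :: "'a hibi_ring" is 1 .
lift_definition plus_hibi_ring :: "'a hibi_ring \<Rightarrow> 'a hibi_ring \<Rightarrow> 'a hibi_ring" is "(+)"
  by (simp add: hibi_rel_push push_plus)
lift_definition minus_hibi_ring :: "'a hibi_ring \<Rightarrow> 'a hibi_ring \<Rightarrow> 'a hibi_ring" is "(-)"
  by (simp add: hibi_rel_push push_minus)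
lift_definition uminus_hibi_ring :: "'a hibi_ring \<Rightarrow> 'a hibi_ring" is uminus
  by (simp add: hibi_rel_push push_minus[of _ 0, simplified] push_zero)
lift_definition times_hibi_ring :: "'a hibi_ring \<Rightarrow> 'a hibi_ring \<Rightarrow> 'a hibi_ring" is "(*)"
  by (simp add: hibi_rel_push push_times[OF jweight_plus])

instance
proof
  fix a b c :: "'a hibi_ring"
  show "a + b + c = a + (b + c)" by transfer (simp add: hibi_rel_push algebra_simps)
  show "a + b = b + a" by transfer (simp add: hibi_rel_push algebra_simps)
  show "0 + a = a" by transfer (simp add: hibi_rel_push)
  show "- a + a = 0" by transfer (simp add: hibi_rel_push)
  show "a - b = a + - b" by transfer (simp add: hibi_rel_push)
  show "a * b * c = a * (b * c)" by transfer (simp add: hibi_rel_push algebra_simps)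
  show "a * b = b * a" by transfer (simp add: hibi_rel_push algebra_simps)
  show "1 * a = a" by transfer (simp add: hibi_rel_push)
  show "(a + b) * c = a * c + b * c" by transfer (simp add: hibi_rel_push algebra_simps)
  show "0 * a = 0" by transfer (simp add: hibi_rel_push)
  show "a * 0 = 0" by transfer (simp add: hibi_rel_push)
  show "a * (b + c) = a * b + a * c" by transfer (simp add: hibi_rel_push algebra_simps)
  show "(0 :: 'a hibi_ring) \<noteq> 1"
    by transfer (use one_notin_hibi_ideal in \<open>auto simp: hibi_rel_push hibi_ideal_iff push_zero\<close>)
  show "a \<noteq> 0 \<Longrightarrow> b \<noteq> 0 \<Longrightarrow> a * b \<noteq> 0"
    by transfer (use hibi_ideal_prime in \<open>auto simp: hibi_rel_def\<close>)
qed

end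

lift_definition hibi_x :: "'a::{finite, distrib_lattice, bounded_lattice} \<Rightarrow> 'a hibi_ring" is pvar .

lift_definition hibi_const :: "complex \<Rightarrow> 'a::{finite, distrib_lattice, bounded_lattice} hibi_ring"
  is pconst .

definition hibi_homogeneous ::
    "nat \<Rightarrow> 'a::{finite, distrib_lattice, bounded_lattice} hibi_ring \<Rightarrow> bool"
  where "hibi_homogeneous d x \<longleftrightarrow> (\<exists>p. homogeneous_poly d p \<and> x = abs_hibi_ring p)"

section \<open>The function field of the Hibi variety\<close>

lemma homogeneous_poly_alt:
  "homogeneous_poly d p \<longleftrightarrow>
    (\<forall>m\<in>Poly_Mapping.keys p. (\<Sum>v\<in>UNIV. Poly_Mapping.lookup m v) = d)"
  for p :: "'v::finite cpoly"
proof -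
  have "(\<Sum>v\<in>Poly_Mapping.keys m. Poly_Mapping.lookup m v) = (\<Sum>v\<in>UNIV. Poly_Mapping.lookup m v)"
    for m :: "'v \<Rightarrow>\<^sub>0 nat"
    by (rule sum.mono_neutral_left) (auto simp: in_keys_iff)
  then show ?thesis by (simp add: homogeneous_poly_def)
qed

lemma homogeneous_poly_add:
  "homogeneous_poly d p \<Longrightarrow> homogeneous_poly d q \<Longrightarrow> homogeneous_poly d (p + q)"
  using keys_add[of p q] unfolding homogeneous_poly_def by blast

lemma homogeneous_poly_mult:
  "homogeneous_poly d p \<Longrightarrow> homogeneous_poly e q \<Longrightarrow> homogeneous_poly (d + e) (p * q)"
  for p q :: "'v::finite cpoly"
  using keys_mult[of p q] unfolding homogeneous_poly_alt
  by (fastforce simp: lookup_add sum.distrib)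

lemma homogeneous_poly_pconst: "homogeneous_poly 0 (pconst c)"
  by (auto simp: homogeneous_poly_def pconst_def)

lemma homogeneous_poly_zero: "homogeneous_poly d 0"
  by (simp add: homogeneous_poly_def)

lemma homogeneous_poly_pvar: "homogeneous_poly 1 (pvar v)"
  by (auto simp: homogeneous_poly_def pvar_def pmonom_def)

lemma homogeneous_poly_uminus: "homogeneous_poly d p \<Longrightarrow> homogeneous_poly d (- p)"
  by (simp add: homogeneous_poly_def keys_def)

lemma hibi_homogeneous_add:
  "hibi_homogeneous d x \<Longrightarrow> hibi_homogeneous d y \<Longrightarrow> hibi_homogeneous d (x + y)"
  unfolding hibi_homogeneous_def by (metis homogeneous_poly_add plus_hibi_ring.abs_eq)

lemma hibi_homogeneous_mult:
  "hibi_homogeneous d x \<Longrightarrow> hibi_homogeneous e y \<Longrightarrow> hibi_homogeneous (d + e) (x * y)"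
  unfolding hibi_homogeneous_def by (metis homogeneous_poly_mult times_hibi_ring.abs_eq)

lemma hibi_homogeneous_uminus: "hibi_homogeneous d x \<Longrightarrow> hibi_homogeneous d (- x)"
  unfolding hibi_homogeneous_def by (metis homogeneous_poly_uminus uminus_hibi_ring.abs_eq)

lemma hibi_homogeneous_const: "hibi_homogeneous 0 (hibi_const c)"
  unfolding hibi_homogeneous_def by (metis homogeneous_poly_pconst hibi_const.abs_eq)

lemma hibi_homogeneous_one: "hibi_homogeneous 0 1"
  unfolding hibi_homogeneous_def one_hibi_ring_def
  using homogeneous_poly_pconst[of 1] by (auto simp: pconst_def)

lemma hibi_homogeneous_zero: "hibi_homogeneous d 0"
  unfolding hibi_homogeneous_def zero_hibi_ring_def using homogeneous_poly_zero by auto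

lemma hibi_homogeneous_x: "hibi_homogeneous 1 (hibi_x a)"
  unfolding hibi_homogeneous_def by (metis homogeneous_poly_pvar hibi_x.abs_eq)

lemma hibi_x_nonzero: "hibi_x a \<noteq> 0"
  by transfer (simp add: hibi_rel_push pvar_def pmonom_def push_single push_zero flip: keys_eq_empty)

text \<open>Rational functions on a projective variety are the quotients of homogeneous elements of the
  same degree of its homogeneous coordinate ring.\<close>

definition degree_zero_fractions ::
    "'a::{finite, distrib_lattice, bounded_lattice} hibi_ring fract set"
  where "degree_zero_fractions =
    {Fract f g | f g. g \<noteq> 0 \<and> (\<exists>d. hibi_homogeneous d f \<and> hibi_homogeneous d g)}"

lemma degree_zero_fractionsI:
  "hibi_homogeneous d f \<Longrightarrow> hibi_homogeneous d g \<Longrightarrow> g \<noteq> 0 \<Longrightarrow> Fract f g \<in> degree_zero_fractions"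
  unfolding degree_zero_fractions_def by blast

lemma degree_zero_fractionsE:
  assumes "h \<in> degree_zero_fractions"
  obtains d f g where "h = Fract f g" "hibi_homogeneous d f" "hibi_homogeneous d g" "g \<noteq> 0"
  using assms unfolding degree_zero_fractions_def by blast

lemma degree_zero_fractions_zero: "0 \<in> degree_zero_fractions"
  unfolding Zero_fract_def
  by (intro degree_zero_fractionsI[of 0] hibi_homogeneous_zero hibi_homogeneous_one one_neq_zero)

lemma degree_zero_fractions_one: "1 \<in> degree_zero_fractions"
  unfolding One_fract_def
  by (intro degree_zero_fractionsI[of 0] hibi_homogeneous_one one_neq_zero)

lemma degree_zero_fractions_add:
  assumes "h \<in> degree_zero_fractions" "h' \<in> degree_zero_fractions"
  shows "h + h' \<in> degree_zero_fractions"
proof -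
  obtain d f g where h: "h = Fract f g" "hibi_homogeneous d f" "hibi_homogeneous d g" "g \<noteq> 0"
    using assms(1) by (rule degree_zero_fractionsE)
  obtain e f' g' where h': "h' = Fract f' g'" "hibi_homogeneous e f'" "hibi_homogeneous e g'" "g' \<noteq> 0"
    using assms(2) by (rule degree_zero_fractionsE)
  have "hibi_homogeneous (d + e) (f' * g)"
    using hibi_homogeneous_mult[OF h(3) h'(2)] by (simp add: mult.commute)
  then have "Fract (f * g' + f' * g) (g * g') \<in> degree_zero_fractions"
    using h h' by (intro degree_zero_fractionsI[of "d + e"] hibi_homogeneous_add)
      (auto intro: hibi_homogeneous_mult)
  then show ?thesis using h h' by simp
qed

lemma degree_zero_fractions_uminus:
  assumes "h \<in> degree_zero_fractions"
  shows "- h \<in> degree_zero_fractions"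
  using assms by (elim degree_zero_fractionsE) (auto intro!: degree_zero_fractionsI hibi_homogeneous_uminus)

lemma degree_zero_fractions_mult:
  assumes "h \<in> degree_zero_fractions" "h' \<in> degree_zero_fractions"
  shows "h * h' \<in> degree_zero_fractions"
  using assms
  by (elim degree_zero_fractionsE) (auto intro!: degree_zero_fractionsI hibi_homogeneous_mult)

lemma degree_zero_fractions_inverse:
  assumes "h \<in> degree_zero_fractions"
  shows "inverse h \<in> degree_zero_fractions"
proof -
  obtain d f g where h: "h = Fract f g" "hibi_homogeneous d f" "hibi_homogeneous d g" "g \<noteq> 0"
    using assms by (rule degree_zero_fractionsE)
  show ?thesis
  proof (cases "f = 0")
    case True
    then have "inverse h = 0" by (simp add: h(1) Zero_fract_def eq_fract)
    then show ?thesis by (simp add: degree_zero_fractions_zero)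
  next
    case False
    then show ?thesis using h by (auto intro: degree_zero_fractionsI)
  qed
qed

typedef (overloaded) 'a hibi_field =
  "degree_zero_fractions :: 'a::{finite, distrib_lattice, bounded_lattice} hibi_ring fract set"
  morphisms fract_of Abs_hibi_field
  using degree_zero_fractions_zero by blast

setup_lifting type_definition_hibi_field

instantiation hibi_field :: ("{finite, distrib_lattice, bounded_lattice}") field
begin

lift_definition zero_hibi_field :: "'a hibi_field" is 0
  by (rule degree_zero_fractions_zero)
lift_definition one_hibi_field :: "'a hibi_field" is 1
  by (rule degree_zero_fractions_one)
lift_definition plus_hibi_field :: "'a hibi_field \<Rightarrow> 'a hibi_field \<Rightarrow> 'a hibi_field" is "(+)"
  by (rule degree_zero_fractions_add)
lift_definition uminus_hibi_field :: "'a hibi_field \<Rightarrow> 'a hibi_field" is uminus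
  by (rule degree_zero_fractions_uminus)
lift_definition times_hibi_field :: "'a hibi_field \<Rightarrow> 'a hibi_field \<Rightarrow> 'a hibi_field" is "(*)"
  by (rule degree_zero_fractions_mult)
lift_definition inverse_hibi_field :: "'a hibi_field \<Rightarrow> 'a hibi_field" is inverse
  by (rule degree_zero_fractions_inverse)

definition minus_hibi_field :: "'a hibi_field \<Rightarrow> 'a hibi_field \<Rightarrow> 'a hibi_field"
  where "minus_hibi_field a b = a + - b"

definition divide_hibi_field :: "'a hibi_field \<Rightarrow> 'a hibi_field \<Rightarrow> 'a hibi_field"
  where "divide_hibi_field a b = a * inverse b"

instance
proof
  fix a b c :: "'a hibi_field"
  show "a + b + c = a + (b + c)" by transfer (simp add: algebra_simps)
  show "a + b = b + a" by transfer (simp add: algebra_simps)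
  show "0 + a = a" by transfer simp
  show "- a + a = 0" by transfer simp
  show "a - b = a + - b" by (simp add: minus_hibi_field_def)
  show "a * b * c = a * (b * c)" by transfer (simp add: algebra_simps)
  show "a * b = b * a" by transfer (simp add: algebra_simps)
  show "1 * a = a" by transfer simp
  show "(a + b) * c = a * c + b * c" by transfer (simp add: algebra_simps)
  show "(0 :: 'a hibi_field) \<noteq> 1" by transfer simp
  show "a \<noteq> 0 \<Longrightarrow> inverse a * a = 1" by transfer simp
  show "a div b = a * inverse b" by (simp add: divide_hibi_field_def)
  show "inverse (0 :: 'a hibi_field) = 0" by transfer simp
qed

end

lift_definition ff_const :: "complex \<Rightarrow> 'a::{finite, distrib_lattice, bounded_lattice} hibi_field"
  is "\<lambda>c. Fract (hibi_const c) 1"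
  by (intro degree_zero_fractionsI[of 0] hibi_homogeneous_const hibi_homogeneous_one one_neq_zero)

lift_definition xhat :: "'a::{finite, distrib_lattice, bounded_lattice} \<Rightarrow> 'a hibi_field"
  is "\<lambda>a. Fract (hibi_x a) (hibi_x bot)"
  by (intro degree_zero_fractionsI[of 1] hibi_homogeneous_x hibi_x_nonzero)

section \<open>The valuation of a maximal chain\<close>

abbreviation maximal_chain :: "'a::order set \<Rightarrow> bool"
  where "maximal_chain C \<equiv> pred_on.maxchain UNIV (<) C"

text \<open>The element $c_j$ of the chain $c_0 < \dots < c_N$ is the one with exactly \<open>j\<close> chain
  elements strictly below it, and \<open>N = chain_length C\<close>.\<close>

definition chain_elem :: "'a::order set \<Rightarrow> nat \<Rightarrow> 'a"
  where "chain_elem C j = (THE c. c \<in> C \<and> card {d \<in> C. d < c} = j)"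

definition chain_length :: "'a set \<Rightarrow> nat"
  where "chain_length C = card C - 1"

text \<open>
  Values in $\mathbb{Z}^N$ are finitely supported integer functions, with coordinates indexed from 1.
  The linear order that the library puts on such functions compares the values at the least index
  where they differ; indexing by \<open>nat dual\<close> therefore yields the reverse lexicographic order, as
  \<open>less_revlex_iff\<close> below confirms.
\<close>

instance dual :: (linorder) linorder
  by standard (auto simp: less_eq_dual.rep_eq)

type_synonym zvec = "nat dual \<Rightarrow>\<^sub>0 int"

definition unit_vec :: "nat \<Rightarrow> zvec"
  where "unit_vec j = frag_of (dual j)"

lemma less_revlex_iff:
  "a < b \<longleftrightarrow> (\<exists>j. Poly_Mapping.lookup a (dual j) < Poly_Mapping.lookup b (dual j) \<and>
     (\<forall>i>j. Poly_Mapping.lookup a (dual i) = Poly_Mapping.lookup b (dual i)))"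
  for a b :: zvec
proof -
  have ex: "(\<exists>k. P k) \<longleftrightarrow> (\<exists>j. P (dual j))" and all: "(\<forall>k. P k) \<longleftrightarrow> (\<forall>j. P (dual j))"
    for P :: "nat dual \<Rightarrow> bool"
    by (metis dual_undual)+
  show ?thesis
    unfolding less_poly_mapping.rep_eq less_fun_def ex all by simp
qed

definition exponent_vec :: "(nat \<Rightarrow>\<^sub>0 nat) \<Rightarrow> zvec"
  where "exponent_vec m =
    (\<Sum>j\<in>Poly_Mapping.keys m. frag_cmul (int (Poly_Mapping.lookup m j)) (unit_vec j))"

definition chain_polys :: "'a set \<Rightarrow> nat cpoly set"
  where "chain_polys C = {f. \<forall>m\<in>Poly_Mapping.keys f. Poly_Mapping.keys m \<subseteq> {1..chain_length C}}"

definition chain_eval ::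
    "'a::{finite, distrib_lattice, bounded_lattice} set \<Rightarrow> nat cpoly \<Rightarrow> 'a hibi_field"
  where "chain_eval C f = (\<Sum>m\<in>Poly_Mapping.keys f. ff_const (Poly_Mapping.lookup f m) *
    (\<Prod>j\<in>Poly_Mapping.keys m. xhat (chain_elem C j) ^ Poly_Mapping.lookup m j))"

definition poly_val :: "nat cpoly \<Rightarrow> zvec"
  where "poly_val f = Min (exponent_vec ` Poly_Mapping.keys f)"

text \<open>The value below is meant for \<open>h \<noteq> 0\<close>. The polynomials are formal: since
  $\hat x_{c_1}, \dots, \hat x_{c_N}$ are algebraically independent generators of the function
  field, such a presentation exists and the value does not depend on it.\<close>

definition nu_chain ::
    "'a::{finite, distrib_lattice, bounded_lattice} set \<Rightarrow> 'a hibi_field \<Rightarrow> zvec"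
  where "nu_chain C h = (THE v. \<exists>f g. f \<in> chain_polys C \<and> g \<in> chain_polys C \<and> f \<noteq> 0 \<and> g \<noteq> 0 \<and>
    h = chain_eval C f / chain_eval C g \<and> v = poly_val f - poly_val g)"

definition nu_ht :: "'a::{finite, distrib_lattice, bounded_lattice} hibi_field \<Rightarrow> zvec"
  where "nu_ht h = Min ((\<lambda>C. nu_chain C h) ` {C. maximal_chain C})"

definition xhat_monomial ::
    "nat \<Rightarrow> (nat \<Rightarrow> 'a::{finite, distrib_lattice, bounded_lattice}) \<Rightarrow> (nat \<Rightarrow> nat) \<Rightarrow> 'a hibi_field"
  where "xhat_monomial k l n = (\<Prod>j=1..k. xhat (l j) ^ n j)"

text \<open>Standardness is a property of the written monomial, i.e. of its indices.\<close>

definition standard_indices :: "nat \<Rightarrow> (nat \<Rightarrow> 'a::order) \<Rightarrow> bool"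
  where "standard_indices k l \<longleftrightarrow> (\<forall>i\<in>{1..k}. \<forall>j\<in>{1..k}. l i \<le> l j \<or> l j \<le> l i)"

text \<open>
  The minimum defining \<open>nu_ht\<close> is attained, and a maximal chain cannot contain incomparable
  indices. So ``\<open>nu_ht\<close> and \<open>nu_chain C\<close> agree on a monomial only if its indices lie in \<open>C\<close>'' fails
  for every non-standard monomial, and can only be asserted for standard ones. In the Boolean
  lattice with atoms \<open>a\<close>, \<open>b\<close>, for instance, \<open>xhat a * xhat b = xhat top\<close>.
\<close>

lemma nu_ht_attained:
  fixes h :: "'a::{finite, distrib_lattice, bounded_lattice} hibi_field"
  shows "\<exists>C. maximal_chain C \<and> nu_ht h = nu_chain C h"
proof -
  have "{C :: 'a set. maximal_chain C} \<noteq> {}"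
    using pred_on.Hausdorff[of "UNIV :: 'a set" "(<)"] by blast
  then have "nu_ht h \<in> (\<lambda>C. nu_chain C h) ` {C. maximal_chain C}"
    unfolding nu_ht_def by (intro Min_in) auto
  then show ?thesis by blast
qed

lemma maximal_chain_subset_standard:
  assumes "maximal_chain C" "l ` {1..k} \<subseteq> C"
  shows "standard_indices k l"
proof -
  have "x \<le> y \<or> y \<le> x" if "x \<in> C" "y \<in> C" for x y
    using assms(1) that pred_on.maxchain_imp_chain[of UNIV "(<)" C]
      pred_on.chain_total[of UNIV "(<)" C x y]
    by (auto intro: less_imp_le)
  then show ?thesis using assms(2) unfolding standard_indices_def by blast
qed

lemma nonstandard_equality_outside_chain:
  assumes "\<not> standard_indices k l"
  shows "\<exists>C. maximal_chain C \<and>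
    nu_ht (xhat_monomial k l n) = nu_chain C (xhat_monomial k l n) \<and> \<not> l ` {1..k} \<subseteq> C"
  using nu_ht_attained maximal_chain_subset_standard assms by metis

end

theory Submission
  imports Defs
begin

text \<open>
  Since the chain variables are algebraically independent, the value of a Laurent monomial in them
  is its exponent vector, and every \<open>xhat a\<close> is such a Laurent monomial for every maximal chain
  \<open>C\<close>. If \<open>a\<close> lies in \<open>C\<close>, its value is the unit vector at the height of \<open>a\<close>, which does not
  depend on \<open>C\<close>. Otherwise the last nonzero entry of its value is 1 and stands at the height of the
  least element of \<open>C\<close> above \<open>a\<close>, so the value is strictly larger. By additivity the value of a
  monomial under \<open>C\<close> is at least the sum of the unit vectors of its factors, with equality exactly
  when all indices lie in \<open>C\<close>, and all three claims follow.
\<close>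

section \<open>Maximal chains\<close>

text \<open>This is the rank function: in a finite distributive lattice the rank counts the join
  irreducibles below an element. Since \<open>bot\<close> counts as join prime here and lies below
  everything, one is subtracted.\<close>

definition height :: "'a::{finite, distrib_lattice, bounded_lattice} \<Rightarrow> nat"
  where "height a = jrank a - 1"

lemma maximal_chain_total:
  "maximal_chain C \<Longrightarrow> a \<in> C \<Longrightarrow> b \<in> C \<Longrightarrow> a \<le> b \<or> b \<le> a"
  using pred_on.maxchain_imp_chain[of UNIV "(<)" C] pred_on.chain_total[of UNIV "(<)" C a b]
  by (auto intro: less_imp_le)

text \<open>Otherwise adjoining \<open>a\<close> would give a larger chain, against
  maximality.\<close>

lemma maximal_chain_mem:
  fixes C :: "'a::order set"
  assumes "maximal_chain C" "\<And>c. c \<in> C \<Longrightarrow> a \<le> c \<or> c \<le> a"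
  shows "a \<in> C"
proof (rule ccontr)
  assume "a \<notin> C"
  moreover have "pred_on.chain UNIV (<) (insert a C)"
    using assms(2) maximal_chain_total[OF assms(1)]
    by (auto simp: pred_on.chain_def order.order_iff_strict)
  ultimately show False using assms(1) by (auto simp: pred_on.maxchain_def)
qed

lemma maximal_chain_bot: "maximal_chain C \<Longrightarrow> bot \<in> C" for C :: "'a::order_bot set"
  by (rule maximal_chain_mem) auto

lemma maximal_chain_top: "maximal_chain C \<Longrightarrow> top \<in> C" for C :: "'a::order_top set"
  by (rule maximal_chain_mem) auto

text \<open>Supplies chains through prescribed comparable elements; finiteness provides a maximal
  chain above \<open>S\<close>.\<close>

lemma maximal_chain_extend:
  fixes S :: "'a::{finite, order} set"
  assumes "\<And>a b. a \<in> S \<Longrightarrow> b \<in> S \<Longrightarrow> a \<le> b \<or> b \<le> a"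
  obtains C where "maximal_chain C" "S \<subseteq> C"
proof -
  have "S \<in> {D. pred_on.chain UNIV (<) D}"
    using assms by (auto simp: pred_on.chain_def order.order_iff_strict)
  from finite_has_maximal2[OF _ this] obtain C
    where "pred_on.chain UNIV (<) C" "S \<subseteq> C" "\<forall>D. pred_on.chain UNIV (<) D \<longrightarrow> C \<subseteq> D \<longrightarrow> C = D"
    by auto
  then have "maximal_chain C" unfolding pred_on.maxchain_def by blast
  then show ?thesis using that \<open>S \<subseteq> C\<close> by blast
qed

text \<open>Take the greatest chain element below \<open>c\<close>. Anything strictly between the
  two would be comparable with the whole chain and hence belong to it, so neighbours in a maximal
  chain are covers in the lattice.\<close>

lemma maximal_chain_pred:
  fixes C :: "'a::{finite, order_bot} set"
  assumes C: "maximal_chain C" "c \<in> C" "c \<noteq> bot"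
  obtains c' where "c' \<in> C" "c' < c" "\<forall>d\<in>C. d < c \<longrightarrow> d \<le> c'"
    "\<forall>x. c' < x \<longrightarrow> x \<le> c \<longrightarrow> x = c"
proof -
  have "{d \<in> C. d < c} \<noteq> {}"
    using maximal_chain_bot[OF C(1)] C(3) by (auto simp: bot.not_eq_extremum)
  then obtain c' where c': "c' \<in> C" "c' < c" "\<And>d. d \<in> C \<Longrightarrow> d < c \<Longrightarrow> d \<le> c'"
    using finite_chain_top[of "{d \<in> C. d < c}"] maximal_chain_total[OF C(1)]
    by (metis (mono_tags, lifting) finite mem_Collect_eq)
  have "x = c" if x: "c' < x" "x \<le> c" for x
  proof (rule ccontr)
    assume "x \<noteq> c"
    then have "x < c" using x by simp
    have "x \<in> C"
    proof (rule maximal_chain_mem[OF C(1)])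
      fix d assume d: "d \<in> C"
      show "x \<le> d \<or> d \<le> x"
      proof (cases "c \<le> d")
        case True then show ?thesis using x by auto
      next
        case False
        then have "d < c" using maximal_chain_total[OF C(1,2) d] by auto
        then show ?thesis using c'(3)[OF d] x by auto
      qed
    qed
    then show False using c'(3)[OF _ \<open>x < c\<close>] x by auto
  qed
  with c' that show ?thesis by blast
qed

section \<open>Height as the rank function of the lattice\<close>

lemma jrank_bot: "jrank (bot :: 'a::{finite, distrib_lattice, bounded_lattice}) = 1"
proof -
  have "{p :: 'a. jprime p \<and> p \<le> bot} = {bot}"
    using jprime_bot by (auto simp: bot_unique)
  then show ?thesis by (simp add: jrank_def)
qed

lemma jrank_mono: "a \<le> b \<Longrightarrow> jrank a \<le> jrank b"
  using jrank_strict by (metis order.order_iff_strict)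

lemma jrank_pos: "jrank a \<ge> 1"
  using jrank_mono[OF bot_least[of a]] jrank_bot[where 'a='a] by simp

lemma height_mono: "a < b \<Longrightarrow> height a < height b"
  using jrank_strict[of a b] jrank_pos[of a] by (simp add: height_def)

lemma height_bot: "height (bot :: 'a::{finite, distrib_lattice, bounded_lattice}) = 0"
  by (simp add: height_def jrank_bot)

lemma height_pos: "a \<noteq> bot \<Longrightarrow> 0 < height a"
  using height_mono[of bot a] bot.not_eq_extremum[of a] by linarith

text \<open>A cover gains exactly one join prime: at least one because join primes detect the order,
  and at most one by the following exchange argument.\<close>

lemma height_cover:
  fixes a b :: "'a::{finite, distrib_lattice, bounded_lattice}"
  assumes "a < b" and cover: "\<forall>x. a < x \<longrightarrow> x \<le> b \<longrightarrow> x = b"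
  shows "height b = Suc (height a)"
proof -
  obtain q where q: "jprime q" "q \<le> b" "\<not> q \<le> a"
    using jprime_le[of b a] assms(1) by (auto dest: leD)
  have sup: "sup a p = b" if "p \<le> b" "\<not> p \<le> a" for p
    using that assms(1) by (intro cover[rule_format]) (auto simp: less_le_not_le)
  \<comment> \<open>Joining \<open>a\<close> with either of the two gives \<open>b\<close>. Thus
    \<open>q\<close> lies below \<open>sup a p\<close> but not below \<open>a\<close>, so primality
    gives \<open>q \<le> p\<close>, and symmetrically.\<close>
  have "p = q" if "jprime p" "p \<le> b" "\<not> p \<le> a" for p
    using that q sup[of p] sup[of q] jprime_sup_iff by (metis antisym)
  then have "{p. jprime p \<and> p \<le> b} = insert q {p. jprime p \<and> p \<le> a}"
    using q order.strict_implies_order[OF assms(1)] by (blast intro: order.trans)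
  then have "jrank b = Suc (jrank a)"
    using q(3) unfolding jrank_def by simp
  then show ?thesis using jrank_pos[of a] by (simp add: height_def)
qed

section \<open>Heights as positions in a maximal chain\<close>

lemma height_inj_on_chain:
  assumes "maximal_chain C"
  shows "inj_on height C"
proof (rule inj_onI)
  fix a b assume ab: "a \<in> C" "b \<in> C" "height a = height b"
  then have "\<not> a < b" "\<not> b < a" using height_mono by force+
  then show "a = b" using maximal_chain_total[OF assms ab(1,2)] by auto
qed

text \<open>Connects the counting in \<open>chain_elem\<close> with the height: passing from
  \<open>c\<close> to its predecessor in the chain lowers both numbers by one.\<close>

lemma card_below_eq_height:
  fixes c :: "'a::{finite, distrib_lattice, bounded_lattice}"
  assumes "maximal_chain C"
  shows "c \<in> C \<Longrightarrow> card {d \<in> C. d < c} = height c"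
proof (induction "height c" arbitrary: c rule: less_induct)
  case less
  show ?case
  proof (cases "c = bot")
    case True
    then show ?thesis by (simp add: height_bot)
  next
    case False
    obtain c' where c': "c' \<in> C" "c' < c" "\<forall>d\<in>C. d < c \<longrightarrow> d \<le> c'"
      "\<forall>x. c' < x \<longrightarrow> x \<le> c \<longrightarrow> x = c"
      using maximal_chain_pred[OF assms less.prems False] .
    have "{d \<in> C. d < c} = insert c' {d \<in> C. d < c'}"
      using c'(1-3) by (auto simp: order.order_iff_strict)
    then show ?thesis
      using less.hyps[OF height_mono[OF c'(2)] c'(1)] height_cover[OF c'(2,4)] by simp
  qed
qed

lemma chain_elem_height:
  assumes "maximal_chain C" "c \<in> C"
  shows "chain_elem C (height c) = c"
  unfolding chain_elem_def
proof (rule the_equality)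
  fix d assume d: "d \<in> C \<and> card {x \<in> C. x < d} = height c"
  then have "height d = height c" using card_below_eq_height[OF assms(1), of d] by simp
  then show "d = c" using height_inj_on_chain[OF assms(1)] assms(2) d by (simp add: inj_on_eq_iff)
qed (simp add: card_below_eq_height[OF assms] assms(2))

text \<open>All other chain elements lie below \<open>top\<close>, so counting below
  \<open>top\<close> gives the length, which is therefore common to all maximal chains.\<close>

lemma chain_length_eq_height:
  fixes C :: "'a::{finite, distrib_lattice, bounded_lattice} set"
  assumes "maximal_chain C"
  shows "chain_length C = height (top :: 'a)"
proof -
  have "{d \<in> C. d < top} = C - {top}" using top.not_eq_extremum by blast
  then show ?thesis
    using card_below_eq_height[OF assms maximal_chain_top[OF assms]] maximal_chain_top[OF assms]
    by (simp add: chain_length_def)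
qed

lemma height_image_chain:
  fixes C :: "'a::{finite, distrib_lattice, bounded_lattice} set"
  assumes "maximal_chain C"
  shows "height ` C = {0..chain_length C}"
proof (rule card_subset_eq)
  show "height ` C \<subseteq> {0..chain_length C}"
    unfolding chain_length_eq_height[OF assms] height_def
    by (simp add: image_subset_iff diff_le_mono jrank_mono)
  \<comment> \<open>Non-emptiness makes the truncated \<open>card C - 1\<close> exact, so both sides
    have \<open>card C\<close> elements.\<close>
  have "card C > 0"
    using maximal_chain_bot[OF assms] by (auto simp: card_gt_0_iff)
  then show "card (height ` C) = card {0..chain_length C}"
    by (simp add: card_image[OF height_inj_on_chain[OF assms]] chain_length_def)
qed simp

lemma chain_elem_mem:
  assumes "maximal_chain C" "j \<le> chain_length C"
  shows "chain_elem C j \<in> C" "height (chain_elem C j) = j"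
proof -
  have "j \<in> height ` C" using height_image_chain[OF assms(1)] assms(2) by simp
  then show "chain_elem C j \<in> C" "height (chain_elem C j) = j"
    using chain_elem_height[OF assms(1)] by auto
qed

section \<open>Well-definedness of the valuation of a chain\<close>

lemma lookup_exponent_vec: "Poly_Mapping.lookup (exponent_vec m) (dual j) = int (Poly_Mapping.lookup m j)"
  by (simp add: exponent_vec_def unit_vec_def lookup_sum when_def if_distrib in_keys_iff cong: if_cong)

lemma zvec_eqI: "(\<And>j. Poly_Mapping.lookup v (dual j) = Poly_Mapping.lookup w (dual j)) \<Longrightarrow> v = w"
  for v w :: zvec
  by (intro poly_mapping_eqI) (metis dual_undual)

lemma exponent_vec_plus: "exponent_vec (m + m') = exponent_vec m + exponent_vec m'"
  by (rule zvec_eqI) (simp add: lookup_exponent_vec lookup_add)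

text \<open>Makes the monomial of lowest value unique, which excludes cancellation in
  \<open>poly_val_mult\<close>.\<close>

lemma exponent_vec_inj: "exponent_vec m = exponent_vec m' \<Longrightarrow> m = m'"
  by (intro poly_mapping_eqI) (metis lookup_exponent_vec of_nat_eq_iff)

lemma poly_val_le: "m \<in> Poly_Mapping.keys f \<Longrightarrow> poly_val f \<le> exponent_vec m"
  unfolding poly_val_def by (intro Min_le) auto

lemma poly_val_attained:
  assumes "f \<noteq> 0"
  obtains m where "m \<in> Poly_Mapping.keys f" "poly_val f = exponent_vec m"
proof -
  have "poly_val f \<in> exponent_vec ` Poly_Mapping.keys f"
    unfolding poly_val_def using assms by (intro Min_in) auto
  then show ?thesis using that by blast
qed

text \<open>The order is total and compatible with addition, so the product of the two lowest terms
  survives and is lowest in the product.\<close>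

lemma poly_val_mult:
  assumes "f \<noteq> 0" "g \<noteq> 0"
  shows "poly_val (f * g) = poly_val f + poly_val g"
proof -
  obtain m where m: "m \<in> Poly_Mapping.keys f" "poly_val f = exponent_vec m"
    using poly_val_attained[OF assms(1)] .
  obtain m' where m': "m' \<in> Poly_Mapping.keys g" "poly_val g = exponent_vec m'"
    using poly_val_attained[OF assms(2)] .
  \<comment> \<open>Split off the lowest terms; all exponents remaining in \<open>f1\<close> and
    \<open>g1\<close> are strictly larger.\<close>
  define c where "c = Poly_Mapping.lookup f m"
  define c' where "c' = Poly_Mapping.lookup g m'"
  define f1 where "f1 = f - Poly_Mapping.single m c"
  define g1 where "g1 = g - Poly_Mapping.single m' c'"
  have f1: "exponent_vec m < exponent_vec a" if "a \<in> Poly_Mapping.keys f1" for a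
  proof -
    have "a \<noteq> m" "a \<in> Poly_Mapping.keys f"
      using that by (auto simp: f1_def c_def in_keys_iff lookup_minus lookup_single when_def split: if_splits)
    then show ?thesis using poly_val_le[of a f] exponent_vec_inj m(2) by (metis order.not_eq_order_implies_strict)
  qed
  have g1: "exponent_vec m' < exponent_vec a" if "a \<in> Poly_Mapping.keys g1" for a
  proof -
    have "a \<noteq> m'" "a \<in> Poly_Mapping.keys g"
      using that by (auto simp: g1_def c'_def in_keys_iff lookup_minus lookup_single when_def split: if_splits)
    then show ?thesis using poly_val_le[of a g] exponent_vec_inj m'(2) by (metis order.not_eq_order_implies_strict)
  qed
  have "m + m' \<notin> Poly_Mapping.keys (Poly_Mapping.single m c * g1)"
    using keys_mult[of "Poly_Mapping.single m c" g1] g1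
    by (fastforce split: if_splits)
  moreover have "m + m' \<notin> Poly_Mapping.keys (f1 * g)"
  proof
    assume "m + m' \<in> Poly_Mapping.keys (f1 * g)"
    then obtain a b where "m + m' = a + b" "a \<in> Poly_Mapping.keys f1" "b \<in> Poly_Mapping.keys g"
      using keys_mult[of f1 g] by blast
    then have "exponent_vec m + exponent_vec m' = exponent_vec a + exponent_vec b"
      "exponent_vec m < exponent_vec a" "exponent_vec m' \<le> exponent_vec b"
      using f1 poly_val_le[of b g] m'(2) by (auto simp flip: exponent_vec_plus)
    then show False using add_less_le_mono[of "exponent_vec m" "exponent_vec a"] by fastforce
  qed
  \<comment> \<open>The last two summands have no term at \<open>m + m'\<close>, so only
    \<open>c * c'\<close> contributes there.\<close>
  moreover have "f * g = Poly_Mapping.single (m + m') (c * c') + Poly_Mapping.single m c * g1 + f1 * g"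
    by (simp add: f1_def g1_def algebra_simps mult_single)
  ultimately have "Poly_Mapping.lookup (f * g) (m + m') = c * c'"
    by (simp add: lookup_add in_keys_iff)
  moreover have "c * c' \<noteq> 0" using m(1) m'(1) by (simp add: c_def c'_def in_keys_iff)
  ultimately have mem: "m + m' \<in> Poly_Mapping.keys (f * g)" by (simp add: in_keys_iff)
  show ?thesis
    unfolding poly_val_def[of "f * g"]
  proof (rule Min_eqI)
    fix v assume "v \<in> exponent_vec ` Poly_Mapping.keys (f * g)"
    then obtain a b where "v = exponent_vec a + exponent_vec b" "a \<in> Poly_Mapping.keys f" "b \<in> Poly_Mapping.keys g"
      using keys_mult[of f g] by (auto simp: exponent_vec_plus)
    then show "poly_val f + poly_val g \<le> v"
      using poly_val_le[of a f] poly_val_le[of b g] by (auto intro: add_mono)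
  next
    show "poly_val f + poly_val g \<in> exponent_vec ` Poly_Mapping.keys (f * g)"
      using mem m(2) m'(2) by (simp add: image_eqI flip: exponent_vec_plus)
  qed simp
qed

lemma poly_val_pmonom: "poly_val (pmonom m) = exponent_vec m"
  by (simp add: poly_val_def pmonom_def)

section \<open>Evaluation at the chain variables as a ring homomorphism\<close>

definition chain_monom ::
    "'a::{finite, distrib_lattice, bounded_lattice} set \<Rightarrow> (nat \<Rightarrow>\<^sub>0 nat) \<Rightarrow> 'a hibi_field"
  where "chain_monom C m =
    (\<Prod>j\<in>Poly_Mapping.keys m. xhat (chain_elem C j) ^ Poly_Mapping.lookup m j)"

lemma chain_monom_superset:
  assumes "finite S" "Poly_Mapping.keys m \<subseteq> S"
  shows "chain_monom C m = (\<Prod>j\<in>S. xhat (chain_elem C j) ^ Poly_Mapping.lookup m j)"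
  unfolding chain_monom_def
  by (rule prod.mono_neutral_left) (use assms in \<open>auto simp: in_keys_iff\<close>)

lemma chain_monom_plus: "chain_monom C (m + m') = chain_monom C m * chain_monom C m'"
proof -
  let ?S = "Poly_Mapping.keys m \<union> Poly_Mapping.keys m'"
  have "chain_monom C (m + m') =
      (\<Prod>j\<in>?S. xhat (chain_elem C j) ^ Poly_Mapping.lookup (m + m') j)"
    by (rule chain_monom_superset) (use keys_add[of m m'] in auto)
  also have "\<dots> = chain_monom C m * chain_monom C m'"
    by (simp add: chain_monom_superset[of ?S m] chain_monom_superset[of ?S m'] lookup_add
        power_add prod.distrib)
  finally show ?thesis .
qed

lemma ff_const_add: "ff_const (c + d) = ff_const c + ff_const d"
  by transfer (simp add: hibi_const_def plus_hibi_ring.abs_eq pconst_def single_add)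

lemma ff_const_mult: "ff_const (c * d) = ff_const c * ff_const d"
  by transfer (simp add: hibi_const_def times_hibi_ring.abs_eq pconst_def mult_single)

lemma ff_const_zero: "ff_const 0 = 0"
  using ff_const_add[of 0 0] by (metis add.right_neutral add_left_cancel)

lemma ff_const_one: "ff_const 1 = 1"
  by transfer (simp add: hibi_const_def pconst_def one_hibi_ring_def One_fract_def)

lemma chain_eval_superset:
  assumes "finite S" "Poly_Mapping.keys f \<subseteq> S"
  shows "chain_eval C f = (\<Sum>m\<in>S. ff_const (Poly_Mapping.lookup f m) * chain_monom C m)"
  unfolding chain_eval_def chain_monom_def
  by (rule sum.mono_neutral_left) (use assms in \<open>auto simp: in_keys_iff ff_const_zero\<close>)

lemma chain_eval_zero: "chain_eval C 0 = 0"
  by (simp add: chain_eval_def)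

lemma chain_eval_single: "chain_eval C (Poly_Mapping.single m c) = ff_const c * chain_monom C m"
  using chain_eval_superset[of "{m}" "Poly_Mapping.single m c" C] by simp

lemma chain_eval_pmonom: "chain_eval C (pmonom m) = chain_monom C m"
  by (simp add: pmonom_def chain_eval_single ff_const_one)

lemma chain_eval_plus: "chain_eval C (f + g) = chain_eval C f + chain_eval C g"
proof -
  let ?S = "Poly_Mapping.keys f \<union> Poly_Mapping.keys g"
  have "chain_eval C (f + g) =
      (\<Sum>m\<in>?S. ff_const (Poly_Mapping.lookup (f + g) m) * chain_monom C m)"
    by (rule chain_eval_superset) (use keys_add[of f g] in auto)
  also have "\<dots> = chain_eval C f + chain_eval C g"
    by (simp add: chain_eval_superset[of ?S f] chain_eval_superset[of ?S g] lookup_add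
        ff_const_add distrib_right sum.distrib)
  finally show ?thesis .
qed

lemma chain_eval_minus: "chain_eval C (f - g) = chain_eval C f - chain_eval C g"
  by (metis add_diff_cancel_right' diff_add_cancel chain_eval_plus)

lemma chain_eval_times: "chain_eval C (f * g) = chain_eval C f * chain_eval C g"
proof (induction f rule: poly_mapping_add_induct)
  case 1 then show ?case by (simp add: chain_eval_zero)
next
  case (2 m c)
  show ?case
    by (induction g rule: poly_mapping_add_induct)
      (auto simp: chain_eval_zero chain_eval_single chain_eval_plus mult_single chain_monom_plus
        ff_const_mult distrib_left)
next
  case (3 p q) then show ?case by (simp add: chain_eval_plus distrib_right)
qed

section \<open>Algebraic independence of the chain variables by homogenization\<close>

lemma push_eq_zero:
  assumes "inj_on f (Poly_Mapping.keys p)" "push f p = 0"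
  shows "p = 0"
proof (rule ccontr)
  assume "p \<noteq> 0"
  then obtain m where m: "m \<in> Poly_Mapping.keys p" by fastforce
  \<comment> \<open>By injectivity no other coefficient is moved to the place
    \<open>f m\<close>.\<close>
  have "Poly_Mapping.lookup (push f p) (f m) =
      (\<Sum>a\<in>Poly_Mapping.keys p. if a = m then Poly_Mapping.lookup p a else 0)"
    unfolding push_def lookup_sum
    by (rule sum.cong) (use assms(1) m in \<open>auto simp: lookup_single when_def dest: inj_onD\<close>)
  also have "\<dots> = Poly_Mapping.lookup p m" using m by simp
  finally show False using assms(2) m by (simp add: in_keys_iff)
qed

lemma abs_pmonom_single: "abs_hibi_ring (pmonom (Poly_Mapping.single a i)) = hibi_x a ^ i"
proof (induction i)
  case 0
  then show ?case by (simp add: pmonom_def one_hibi_ring_def)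
next
  case (Suc i)
  have "Poly_Mapping.single a (Suc i) = Poly_Mapping.single a 1 + Poly_Mapping.single a i"
    by (simp flip: single_add)
  then show ?case
    using Suc by (simp add: pmonom_plus hibi_x_def pvar_def flip: times_hibi_ring.abs_eq)
qed

lemma abs_pmonom_sum:
  "finite S \<Longrightarrow> abs_hibi_ring (pmonom (\<Sum>j\<in>S. u j)) = (\<Prod>j\<in>S. abs_hibi_ring (pmonom (u j)))"
proof (induction rule: finite_induct)
  case empty
  then show ?case by (simp add: pmonom_def one_hibi_ring_def)
qed (simp add: pmonom_plus flip: times_hibi_ring.abs_eq)

text \<open>Splits fractions, against the direction in which \<open>mult_fract\<close> simplifies;
  hence the deletion of that rule for products below.\<close>

lemma Fract_one_mult: "Fract (r * s) 1 = Fract r 1 * Fract s 1"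
  by simp

lemma Fract_one_power: "Fract (r ^ i) 1 = Fract r 1 ^ i"
  by (induction i) (simp_all only: power_0 power_Suc Fract_one_mult One_fract_def)

lemma Fract_one_prod: "Fract (\<Prod>j\<in>S. r j) 1 = (\<Prod>j\<in>S. Fract (r j) 1)"
  by (induction S rule: infinite_finite_induct)
    (simp_all add: One_fract_def Fract_one_mult del: mult_fract)

lemma Fract_one_add: "Fract (r + s) 1 = Fract r 1 + Fract s 1"
  by simp

lemma Fract_one_sum: "Fract (\<Sum>j\<in>S. r j) 1 = (\<Sum>j\<in>S. Fract (r j) 1)"
  by (induction S rule: infinite_finite_induct)
    (simp_all add: Zero_fract_def Fract_one_add del: add_fract)

lemma fract_of_prod: "fract_of (\<Prod>j\<in>S. h j) = (\<Prod>j\<in>S. fract_of (h j))"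
  by (induction S rule: infinite_finite_induct)
    (simp_all add: one_hibi_field.rep_eq times_hibi_field.rep_eq)

lemma fract_of_sum: "fract_of (\<Sum>j\<in>S. h j) = (\<Sum>j\<in>S. fract_of (h j))"
  by (induction S rule: infinite_finite_induct)
    (simp_all add: zero_hibi_field.rep_eq plus_hibi_field.rep_eq)

lemma fract_of_power: "fract_of (h ^ i) = fract_of h ^ i"
  by (induction i) (simp_all add: one_hibi_field.rep_eq times_hibi_field.rep_eq)

definition total_degree :: "(nat \<Rightarrow>\<^sub>0 nat) \<Rightarrow> nat"
  where "total_degree m = (\<Sum>j\<in>Poly_Mapping.keys m. Poly_Mapping.lookup m j)"

text \<open>Homogenization to degree \<open>d\<close>, with the variable of \<open>bot\<close> as
  the filler. The truncated difference is the true one when \<open>total_degree m \<le> d\<close>,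
  as \<open>fract_of_chain_monom\<close> assumes.\<close>

definition homog_exponent ::
    "'a::{finite, distrib_lattice, bounded_lattice} set \<Rightarrow> nat \<Rightarrow> (nat \<Rightarrow>\<^sub>0 nat) \<Rightarrow> 'a \<Rightarrow>\<^sub>0 nat"
  where "homog_exponent C d m =
    (\<Sum>j\<in>Poly_Mapping.keys m. Poly_Mapping.single (chain_elem C j) (Poly_Mapping.lookup m j)) +
    Poly_Mapping.single bot (d - total_degree m)"

lemma fract_of_chain_monom:
  assumes "total_degree m \<le> d"
  shows "fract_of (chain_monom C m) * Fract (hibi_x bot) 1 ^ d =
    Fract (abs_hibi_ring (pmonom (homog_exponent C d m))) 1"
proof -
  let ?X = "\<lambda>a. Fract (hibi_x a) 1"
  have X: "fract_of (xhat a) = ?X a / ?X bot" for a :: 'a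
    by (simp add: xhat.rep_eq)
  have nz: "?X (bot :: 'a) \<noteq> 0" by (simp add: Zero_fract_def eq_fract hibi_x_nonzero)
  let ?P = "\<Prod>j\<in>Poly_Mapping.keys m. ?X (chain_elem C j) ^ Poly_Mapping.lookup m j"
  have "fract_of (chain_monom C m) = ?P / ?X bot ^ total_degree m"
    by (simp only: chain_monom_def fract_of_prod fract_of_power X power_divide prod_dividef
        total_degree_def power_sum)
  then have "fract_of (chain_monom C m) * ?X bot ^ d = ?P * ?X bot ^ (d - total_degree m)"
    using nz assms by (simp add: power_diff)
  also have "\<dots> = Fract (abs_hibi_ring (pmonom (homog_exponent C d m))) 1"
    by (simp only: homog_exponent_def pmonom_plus times_hibi_ring.abs_eq[symmetric]
        abs_pmonom_sum finite_keys abs_pmonom_single Fract_one_mult Fract_one_prod Fract_one_power)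
  finally show ?thesis .
qed

lemma keys_homog_exponent:
  assumes C: "maximal_chain C" and m: "Poly_Mapping.keys m \<subseteq> {1..chain_length C}"
  shows "Poly_Mapping.keys (homog_exponent C d m) \<subseteq> C"
proof -
  have "Poly_Mapping.keys (\<Sum>j\<in>Poly_Mapping.keys m.
      Poly_Mapping.single (chain_elem C j) (Poly_Mapping.lookup m j)) \<subseteq> C"
  proof
    fix a assume "a \<in> Poly_Mapping.keys (\<Sum>j\<in>Poly_Mapping.keys m.
      Poly_Mapping.single (chain_elem C j) (Poly_Mapping.lookup m j))"
    then have "(\<Sum>j\<in>Poly_Mapping.keys m.
      Poly_Mapping.lookup (Poly_Mapping.single (chain_elem C j) (Poly_Mapping.lookup m j)) a) \<noteq> 0"
      by (simp add: in_keys_iff lookup_sum)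
    then obtain j where "j \<in> Poly_Mapping.keys m"
      "Poly_Mapping.lookup (Poly_Mapping.single (chain_elem C j) (Poly_Mapping.lookup m j)) a \<noteq> 0"
      using sum.not_neutral_contains_not_neutral by blast
    then have "j \<in> Poly_Mapping.keys m" "a = chain_elem C j"
      by (auto simp: lookup_single when_def split: if_splits)
    then show "a \<in> C" using chain_elem_mem(1)[OF C, of j] m by auto
  qed
  then show ?thesis
    using maximal_chain_bot[OF C] unfolding homog_exponent_def
    by (intro order.trans[OF keys_add]) auto
qed

text \<open>Indices start at 1, so the element in question is not \<open>bot\<close> and the filler
  does not disturb its exponent; distinct indices give distinct chain elements by their
  heights.\<close>

lemma lookup_homog_exponent:
  assumes C: "maximal_chain C" and m: "Poly_Mapping.keys m \<subseteq> {1..chain_length C}"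
    and i: "i \<in> {1..chain_length C}"
  shows "Poly_Mapping.lookup (homog_exponent C d m) (chain_elem C i) = Poly_Mapping.lookup m i"
proof -
  have "chain_elem C i \<noteq> bot"
    using chain_elem_mem(2)[OF C, of i] i height_bot[where 'a='a] by force
  moreover have "chain_elem C j = chain_elem C i \<longleftrightarrow> j = i" if "j \<in> Poly_Mapping.keys m" for j
    using chain_elem_mem(2)[OF C, of i] chain_elem_mem(2)[OF C, of j] i m that by force
  then have "(\<Sum>j\<in>Poly_Mapping.keys m.
      Poly_Mapping.lookup (Poly_Mapping.single (chain_elem C j) (Poly_Mapping.lookup m j)) (chain_elem C i)) =
    (\<Sum>j\<in>Poly_Mapping.keys m. if j = i then Poly_Mapping.lookup m j else 0)"
    by (intro sum.cong) (auto simp: lookup_single when_def)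
  ultimately show ?thesis
    by (simp add: homog_exponent_def lookup_add lookup_sum lookup_single when_def in_keys_iff)
qed

text \<open>The homogenized exponents are supported on a chain, hence standard, and
  \<open>jweight\<close> separates standard exponents; the original exponent is then read
  off.\<close>

lemma jweight_homog_exponent_inj:
  assumes C: "maximal_chain C" and f: "f \<in> chain_polys C"
  shows "inj_on (\<lambda>m. jweight (homog_exponent C d m)) (Poly_Mapping.keys f)"
proof (rule inj_onI)
  fix m m' assume mm: "m \<in> Poly_Mapping.keys f" "m' \<in> Poly_Mapping.keys f"
    and eq: "jweight (homog_exponent C d m) = jweight (homog_exponent C d m')"
  have k: "Poly_Mapping.keys m \<subseteq> {1..chain_length C}" "Poly_Mapping.keys m' \<subseteq> {1..chain_length C}"
    using f mm unfolding chain_polys_def by auto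
  have std: "std_exponent (homog_exponent C d x)" if "Poly_Mapping.keys x \<subseteq> {1..chain_length C}" for x
    using keys_homog_exponent[OF C that] maximal_chain_total[OF C] unfolding std_exponent_def by blast
  have "homog_exponent C d m = homog_exponent C d m'"
    by (rule std_exponent_unique[OF std std eq]) (fact k)+
  then show "m = m'"
    using lookup_homog_exponent[OF C k(1)] lookup_homog_exponent[OF C k(2)] k
    by (intro poly_mapping_eqI) (metis in_keys_iff subset_iff)
qed

text \<open>Clearing the powers of \<open>hibi_x bot\<close> turns distinct monomials in the chain variables into
  distinct standard monomials of one degree, and those are linearly independent in the Hibi ring.\<close>

lemma chain_eval_eq_zero:
  fixes C :: "'a::{finite, distrib_lattice, bounded_lattice} set"
  assumes C: "maximal_chain C" and f: "f \<in> chain_polys C" and "chain_eval C f = 0"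
  shows "f = 0"
proof -
  \<comment> \<open>The sum serves as a common bound for the degrees of all monomials of
    \<open>f\<close>.\<close>
  define d where "d = (\<Sum>m\<in>Poly_Mapping.keys f. total_degree m)"
  have d: "total_degree m \<le> d" if "m \<in> Poly_Mapping.keys f" for m
    unfolding d_def using that by (intro member_le_sum) auto
  let ?u = "homog_exponent C d"
  have "0 = fract_of (chain_eval C f) * Fract (hibi_x bot) 1 ^ d"
    by (simp add: assms(3) zero_hibi_field.rep_eq)
  also have "\<dots> = (\<Sum>m\<in>Poly_Mapping.keys f. fract_of (ff_const (Poly_Mapping.lookup f m)) *
      (fract_of (chain_monom C m) * Fract (hibi_x bot) 1 ^ d))"
    by (simp add: chain_eval_def chain_monom_def fract_of_sum times_hibi_field.rep_eq
        sum_distrib_right mult.assoc)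
  also have "\<dots> = (\<Sum>m\<in>Poly_Mapping.keys f. Fract (hibi_const (Poly_Mapping.lookup f m)) 1 *
      Fract (abs_hibi_ring (pmonom (?u m))) 1)"
    by (rule sum.cong[OF refl]) (simp only: fract_of_chain_monom[OF d] ff_const.rep_eq)
  also have "\<dots> = Fract (\<Sum>m\<in>Poly_Mapping.keys f.
      abs_hibi_ring (Poly_Mapping.single (?u m) (Poly_Mapping.lookup f m))) 1"
    by (simp add: Fract_one_sum hibi_const_def times_hibi_ring.abs_eq pconst_def pmonom_def
        mult_single)
  finally have "(\<Sum>m\<in>Poly_Mapping.keys f.
      abs_hibi_ring (Poly_Mapping.single (?u m) (Poly_Mapping.lookup f m))) = 0"
    by (simp add: Zero_fract_def eq_fract)
  moreover have "(\<Sum>m\<in>S. abs_hibi_ring (Poly_Mapping.single (?u m) (Poly_Mapping.lookup f m))) =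
      abs_hibi_ring (\<Sum>m\<in>S. Poly_Mapping.single (?u m) (Poly_Mapping.lookup f m))" if "finite S" for S
    using that by induction (simp_all add: zero_hibi_ring_def plus_hibi_ring.abs_eq)
  ultimately have "abs_hibi_ring (push ?u f) = abs_hibi_ring 0"
    by (simp add: push_def zero_hibi_ring_def)
  \<comment> \<open>Equality in the Hibi ring is equality after \<open>push jweight\<close>;
    composed with the homogenization this map is injective on the exponents of
    \<open>f\<close>.\<close>
  then have "push jweight (push ?u f) = 0"
    by (simp add: hibi_ring.abs_eq_iff hibi_rel_push push_zero)
  then show ?thesis
    using push_eq_zero[OF jweight_homog_exponent_inj[OF C f]] by (simp add: push_comp)
qed

section \<open>Values of fractions in the chain variables\<close>

lemma chain_polys_mult:
  assumes "f \<in> chain_polys C" "g \<in> chain_polys C"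
  shows "f * g \<in> chain_polys C"
  unfolding chain_polys_def
proof (intro CollectI ballI)
  fix m assume "m \<in> Poly_Mapping.keys (f * g)"
  then obtain a b where "m = a + b" "a \<in> Poly_Mapping.keys f" "b \<in> Poly_Mapping.keys g"
    using keys_mult[of f g] by blast
  then show "Poly_Mapping.keys m \<subseteq> {1..chain_length C}"
    using assms keys_add[of a b] unfolding chain_polys_def by blast
qed

lemma chain_polys_minus:
  assumes "f \<in> chain_polys C" "g \<in> chain_polys C"
  shows "f - g \<in> chain_polys C"
  using assms keys_diff[of f g] unfolding chain_polys_def by blast

text \<open>Two presentations of one element become, after cross-multiplication and by independence,
  an identity \<open>f * g' = f' * g\<close> of formal polynomials; additivity of
  \<open>poly_val\<close> then gives equal differences.\<close>

lemma nu_chain_eq: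
  assumes C: "maximal_chain C"
    and f: "f \<in> chain_polys C" "f \<noteq> 0" and g: "g \<in> chain_polys C" "g \<noteq> 0"
  shows "nu_chain C (chain_eval C f / chain_eval C g) = poly_val f - poly_val g"
  unfolding nu_chain_def
proof (rule the_equality)
  fix v assume "\<exists>f' g'. f' \<in> chain_polys C \<and> g' \<in> chain_polys C \<and> f' \<noteq> 0 \<and> g' \<noteq> 0 \<and>
    chain_eval C f / chain_eval C g = chain_eval C f' / chain_eval C g' \<and>
    v = poly_val f' - poly_val g'"
  then obtain f' g' where f': "f' \<in> chain_polys C" "f' \<noteq> 0" and g': "g' \<in> chain_polys C" "g' \<noteq> 0"
    and eq: "chain_eval C f / chain_eval C g = chain_eval C f' / chain_eval C g'"
    and v: "v = poly_val f' - poly_val g'" by blast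
  \<comment> \<open>Independence also keeps the evaluated denominators from vanishing, so they can
    be cleared.\<close>
  have "chain_eval C (f * g' - f' * g) = 0"
    using eq chain_eval_eq_zero[OF C g(1)] chain_eval_eq_zero[OF C g'(1)] g(2) g'(2)
    by (auto simp: chain_eval_minus chain_eval_times divide_simps split: if_splits)
  then have "f * g' - f' * g = 0"
    by (intro chain_eval_eq_zero[OF C] chain_polys_minus chain_polys_mult f g f' g')
  then have "poly_val f + poly_val g' = poly_val f' + poly_val g"
    using poly_val_mult f(2) g(2) f'(2) g'(2) by (metis eq_iff_diff_eq_0)
  then show "v = poly_val f - poly_val g" unfolding v by (simp add: algebra_simps)
qed (intro exI[of _ f] exI[of _ g] conjI refl f g)

section \<open>Laurent monomials in the variables of a chain\<close>

text \<open>A certificate for values of \<open>nu_chain\<close> that is closed under products,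
  inverses and powers, where the exponent vectors simply add.\<close>

definition laurent_value ::
    "'a::{finite, distrib_lattice, bounded_lattice} set \<Rightarrow> 'a hibi_field \<Rightarrow> zvec \<Rightarrow> bool"
  where "laurent_value C h v \<longleftrightarrow> (\<exists>m m'. Poly_Mapping.keys m \<subseteq> {1..chain_length C} \<and>
    Poly_Mapping.keys m' \<subseteq> {1..chain_length C} \<and>
    h = chain_monom C m / chain_monom C m' \<and> v = exponent_vec m - exponent_vec m')"

lemma laurent_value_nu_chain:
  assumes "maximal_chain C" "laurent_value C h v"
  shows "nu_chain C h = v"
proof -
  obtain m m' where m: "Poly_Mapping.keys m \<subseteq> {1..chain_length C}"
    "Poly_Mapping.keys m' \<subseteq> {1..chain_length C}"
    and h: "h = chain_monom C m / chain_monom C m'" and v: "v = exponent_vec m - exponent_vec m'"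
    using assms(2) unfolding laurent_value_def by blast
  have "pmonom x \<noteq> 0" for x :: "nat \<Rightarrow>\<^sub>0 nat"
    by (simp add: pmonom_def flip: keys_eq_empty)
  moreover have "pmonom m \<in> chain_polys C" "pmonom m' \<in> chain_polys C"
    using m by (simp_all add: chain_polys_def pmonom_def)
  ultimately show ?thesis
    using nu_chain_eq[OF assms(1), of "pmonom m" "pmonom m'"]
    by (simp add: h v chain_eval_pmonom poly_val_pmonom)
qed

lemma exponent_vec_zero: "exponent_vec 0 = 0"
  by (simp add: exponent_vec_def)

lemma laurent_value_one: "laurent_value C 1 0"
  unfolding laurent_value_def
  by (intro exI[of _ 0]) (simp add: chain_monom_def exponent_vec_zero)

lemma laurent_value_mult:
  assumes "laurent_value C h v" "laurent_value C h' v'"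
  shows "laurent_value C (h * h') (v + v')"
proof -
  obtain a b a' b' where "Poly_Mapping.keys a \<subseteq> {1..chain_length C}"
    "Poly_Mapping.keys b \<subseteq> {1..chain_length C}" "Poly_Mapping.keys a' \<subseteq> {1..chain_length C}"
    "Poly_Mapping.keys b' \<subseteq> {1..chain_length C}"
    "h = chain_monom C a / chain_monom C b" "v = exponent_vec a - exponent_vec b"
    "h' = chain_monom C a' / chain_monom C b'" "v' = exponent_vec a' - exponent_vec b'"
    using assms unfolding laurent_value_def by auto
  then show ?thesis
    unfolding laurent_value_def
    using keys_add[of a a'] keys_add[of b b']
    by (intro exI[of _ "a + a'"] exI[of _ "b + b'"])
      (auto simp: chain_monom_plus exponent_vec_plus)
qed

lemma laurent_value_inverse:
  assumes "laurent_value C h v"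
  shows "laurent_value C (inverse h) (- v)"
proof -
  obtain m m' where "Poly_Mapping.keys m \<subseteq> {1..chain_length C}"
    "Poly_Mapping.keys m' \<subseteq> {1..chain_length C}"
    "h = chain_monom C m / chain_monom C m'" "v = exponent_vec m - exponent_vec m'"
    using assms unfolding laurent_value_def by blast
  then show ?thesis
    unfolding laurent_value_def by (intro exI[of _ m'] exI[of _ m]) simp
qed

lemma laurent_value_divide:
  "laurent_value C h v \<Longrightarrow> laurent_value C h' v' \<Longrightarrow> laurent_value C (h / h') (v - v')"
  unfolding divide_inverse diff_conv_add_uminus
  by (rule laurent_value_mult[OF _ laurent_value_inverse])

lemma laurent_value_power:
  assumes "laurent_value C h v"
  shows "laurent_value C (h ^ i) (frag_cmul (int i) v)"
proof (induction i)
  case (Suc i)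
  have "frag_cmul (int (Suc i)) v = v + frag_cmul (int i) v"
    by (simp add: frag_cmul_distrib)
  then show ?case using laurent_value_mult[OF assms Suc] by simp
qed (simp add: laurent_value_one)

lemma laurent_value_prod:
  assumes "\<And>j. j \<in> S \<Longrightarrow> laurent_value C (h j) (v j)"
  shows "laurent_value C (\<Prod>j\<in>S. h j) (\<Sum>j\<in>S. v j)"
  using assms
  by (induction S rule: infinite_finite_induct) (simp_all add: laurent_value_one laurent_value_mult)

section \<open>Values of the coordinate functions\<close>

lemma xhat_nonzero: "xhat a \<noteq> 0"
  by transfer (simp add: Zero_fract_def eq_fract hibi_x_nonzero)

lemma xhat_bot: "xhat bot = 1"
  by transfer (simp add: One_fract_def eq_fract hibi_x_nonzero)

text \<open>The ideal is generated by incomparable pairs; comparing \<open>jweight\<close> treats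
  these and the trivial comparable pairs at once.\<close>

lemma hibi_x_straighten: "hibi_x a * hibi_x b = hibi_x (inf a b) * hibi_x (sup a b)"
proof transfer
  fix a b :: 'a
  show "hibi_rel (pvar a * pvar b) (pvar (inf a b) * pvar (sup a b))"
    using jweight_relation[of a b]
    by (simp add: hibi_rel_push pvar_def pmonom_def mult_single push_single)
qed

lemma xhat_straighten: "xhat a * xhat b = xhat (inf a b) * xhat (sup a b)"
proof transfer
  fix a b :: 'a
  show "Fract (hibi_x a) (hibi_x bot) * Fract (hibi_x b) (hibi_x bot) =
      Fract (hibi_x (inf a b)) (hibi_x bot) * Fract (hibi_x (sup a b)) (hibi_x bot)"
    using hibi_x_straighten[of a b] by simp
qed

text \<open>The value of \<open>xhat a\<close> along any chain through \<open>a\<close>. Coordinates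
  start at 1 and \<open>xhat bot\<close> is 1, so \<open>bot\<close> must get 0 and not
  \<open>unit_vec 0\<close>.\<close>

definition height_vec :: "'a::{finite, distrib_lattice, bounded_lattice} \<Rightarrow> zvec"
  where "height_vec a = (if a = bot then 0 else unit_vec (height a))"

lemma lookup_height_vec:
  "Poly_Mapping.lookup (height_vec a) (dual j) = (if a \<noteq> bot \<and> j = height a then 1 else 0)"
  by (simp add: height_vec_def unit_vec_def)

lemma laurent_value_chain_elem:
  fixes c :: "'a::{finite, distrib_lattice, bounded_lattice}"
  assumes C: "maximal_chain C" "c \<in> C"
  shows "laurent_value C (xhat c) (height_vec c)"
proof (cases "c = bot")
  case True
  then show ?thesis by (simp add: xhat_bot height_vec_def laurent_value_one)
next
  case False
  have "height c \<in> {1..chain_length C}"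
    using height_pos[OF False] height_image_chain[OF C(1)] C(2) by auto
  then show ?thesis
    using False chain_elem_height[OF C] unfolding laurent_value_def
    by (intro exI[of _ "Poly_Mapping.single (height c) 1"] exI[of _ 0])
      (auto simp: chain_monom_def height_vec_def exponent_vec_def)
qed

text \<open>If \<open>c\<close> is the least element of the chain above \<open>a\<close> and \<open>c'\<close> its predecessor in the chain,
  then \<open>sup a c' = c\<close>, so the straightening relation for \<open>a\<close> and \<open>c'\<close> writes \<open>xhat a\<close> as
  \<open>xhat c / xhat c'\<close> times a factor \<open>xhat (inf a c')\<close> of smaller value.\<close>

lemma laurent_value_xhat_below:
  fixes c :: "'a::{finite, distrib_lattice, bounded_lattice}"
  assumes C: "maximal_chain C"
  shows "c \<in> C \<Longrightarrow> a \<le> c \<Longrightarrow> \<exists>v. laurent_value C (xhat a) v \<and>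
    (\<forall>i>height c. Poly_Mapping.lookup v (dual i) = 0) \<and> (a \<notin> C \<longrightarrow> height_vec a < v)"
proof (induction "height c" arbitrary: c a rule: less_induct)
  case less
  show ?case
  proof (cases "a \<in> C")
    case True
    have "height a \<le> height c"
      using less.prems(2) height_mono[of a c] by (auto simp: order.order_iff_strict)
    then show ?thesis
      using laurent_value_chain_elem[OF C True] True
      by (intro exI[of _ "height_vec a"]) (auto simp: lookup_height_vec)
  next
    case False
    have "c \<noteq> bot" using False less.prems maximal_chain_bot[OF C] by (auto simp: bot_unique)
    obtain c' where c': "c' \<in> C" "c' < c" "\<forall>d\<in>C. d < c \<longrightarrow> d \<le> c'"
      "\<forall>x. c' < x \<longrightarrow> x \<le> c \<longrightarrow> x = c"
      using maximal_chain_pred[OF C less.prems(1) \<open>c \<noteq> bot\<close>] .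
    note IH = less.hyps[OF height_mono[OF c'(2)] c'(1)]
    have h: "height c' < height c" using height_mono c'(2) .
    show ?thesis
    proof (cases "a \<le> c'")
      case True
      \<comment> \<open>Here \<open>c\<close> is not yet the least chain element above
        \<open>a\<close>; descend to \<open>c'\<close>, where the support bound is even
        sharper.\<close>
      from IH[OF this] h show ?thesis using order.strict_trans by blast
    next
      case nle: False
      have "sup a c' = c"
        using nle less.prems(2) c'(2) by (intro c'(4)[rule_format]) (auto simp: less_le_not_le)
      then have eq: "xhat a = xhat c / xhat c' * xhat (inf a c')"
        using xhat_straighten[of a c'] xhat_nonzero[of c'] by (simp add: field_simps)
      \<comment> \<open>The support bound carried through the induction is used here:
        \<open>w\<close> vanishes from coordinate \<open>height c\<close> on.\<close>
      obtain w where w: "laurent_value C (xhat (inf a c')) w"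
        "\<forall>i>height c'. Poly_Mapping.lookup w (dual i) = 0"
        using IH[of "inf a c'"] by auto
      define v where "v = height_vec c - height_vec c' + w"
      have "laurent_value C (xhat a) v"
        unfolding v_def eq
        by (intro laurent_value_mult laurent_value_divide laurent_value_chain_elem C less.prems(1) c'(1) w(1))
      moreover have v: "Poly_Mapping.lookup v (dual i) = (if i = height c then 1 else 0)"
        if "i \<ge> height c" for i
        using that h w(2) \<open>c \<noteq> bot\<close> by (auto simp: v_def lookup_add lookup_minus lookup_height_vec)
      moreover have "height_vec a < v"
      proof -
        have "height a < height c"
          using False less.prems by (intro height_mono) (auto simp: order.order_iff_strict)
        \<comment> \<open>Coordinate \<open>height c\<close> decides: \<open>v\<close> has 1 there,
          \<open>height_vec a\<close> has 0, and both vanish beyond.\<close>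
        then show ?thesis
          unfolding less_revlex_iff
          by (intro exI[of _ "height c"]) (auto simp: v lookup_height_vec)
      qed
      ultimately show ?thesis by auto
    qed
  qed
qed

text \<open>The bound \<open>c\<close> of the preceding induction is taken to be \<open>top\<close>,
  which lies in every maximal chain and above every \<open>a\<close>.\<close>

lemma nu_chain_xhat:
  assumes "maximal_chain C"
  shows laurent_value_xhat: "laurent_value C (xhat a) (nu_chain C (xhat a))"
    and nu_chain_xhat_outside: "a \<notin> C \<Longrightarrow> height_vec a < nu_chain C (xhat a)"
proof -
  obtain v where v: "laurent_value C (xhat a) v" "a \<notin> C \<longrightarrow> height_vec a < v"
    using laurent_value_xhat_below[OF assms maximal_chain_top[OF assms] top_greatest[of a]] by blast
  have "nu_chain C (xhat a) = v" using laurent_value_nu_chain[OF assms v(1)] .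
  with v show "laurent_value C (xhat a) (nu_chain C (xhat a))"
    "a \<notin> C \<Longrightarrow> height_vec a < nu_chain C (xhat a)" by simp_all
qed

lemma nu_chain_xhat_chain: "maximal_chain C \<Longrightarrow> a \<in> C \<Longrightarrow> nu_chain C (xhat a) = height_vec a"
  by (rule laurent_value_nu_chain[OF _ laurent_value_chain_elem])

lemma nu_chain_xhat_monomial:
  assumes "maximal_chain C"
  shows "nu_chain C (xhat_monomial k l n) = (\<Sum>j=1..k. frag_cmul (int (n j)) (nu_chain C (xhat (l j))))"
  unfolding xhat_monomial_def
  by (rule laurent_value_nu_chain[OF assms], rule laurent_value_prod, rule laurent_value_power,
      rule laurent_value_xhat[OF assms])

section \<open>The quasi-valuation on monomials\<close>

lemma nu_ht_le: "maximal_chain C \<Longrightarrow> nu_ht h \<le> nu_chain C h"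
  unfolding nu_ht_def by (intro Min_le) auto

text \<open>Some maximal chain passes through \<open>a\<close> and yields this value; chains
  avoiding \<open>a\<close> yield larger ones.\<close>

lemma nu_ht_xhat: "nu_ht (xhat a) = height_vec a"
proof (rule antisym)
  obtain C where "maximal_chain C" "{a} \<subseteq> C" using maximal_chain_extend[of "{a}"] by auto
  then show "nu_ht (xhat a) \<le> height_vec a"
    using nu_ht_le[of C "xhat a"] nu_chain_xhat_chain[of C a] by simp
next
  obtain C where "maximal_chain C" "nu_ht (xhat a) = nu_chain C (xhat a)"
    using nu_ht_attained by blast
  then show "height_vec a \<le> nu_ht (xhat a)"
    using nu_chain_xhat_chain[of C a] nu_chain_xhat_outside[of C a] by (cases "a \<in> C") auto
qed

section \<open>Comparison of monomial values with sums of height vectors\<close>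

lemma frag_cmul_strict_mono:
  fixes v w :: zvec
  assumes "v < w" "0 < i"
  shows "frag_cmul (int i) v < frag_cmul (int i) w"
proof -
  obtain j where "Poly_Mapping.lookup v (dual j) < Poly_Mapping.lookup w (dual j)"
    "\<forall>i>j. Poly_Mapping.lookup v (dual i) = Poly_Mapping.lookup w (dual i)"
    using assms(1) unfolding less_revlex_iff by blast
  then show ?thesis
    unfolding less_revlex_iff using assms(2) by (intro exI[of _ j]) simp
qed

lemma frag_cmul_height_vec_le:
  assumes "maximal_chain C"
  shows "frag_cmul (int i) (height_vec a) \<le> frag_cmul (int i) (nu_chain C (xhat a))"
  using frag_cmul_strict_mono[OF nu_chain_xhat_outside[OF assms]] nu_chain_xhat_chain[OF assms]
  by (cases "a \<in> C"; cases "i = 0") (auto intro: less_imp_le)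

text \<open>No factor falls below its height vector, and one index outside \<open>C\<close> gives a
  strict inequality, which its non-zero exponent preserves.\<close>

lemma sum_height_vec_less:
  assumes C: "maximal_chain C" and n: "\<forall>j\<in>{1..k}. n j \<noteq> 0" and l: "\<not> l ` {1..k} \<subseteq> C"
  shows "(\<Sum>j=1..k. frag_cmul (int (n j)) (height_vec (l j))) < nu_chain C (xhat_monomial k l n)"
  unfolding nu_chain_xhat_monomial[OF C]
proof (rule sum_strict_mono_ex1)
  obtain j where "j \<in> {1..k}" "l j \<notin> C" using l by blast
  then show "\<exists>j\<in>{1..k}. frag_cmul (int (n j)) (height_vec (l j)) <
      frag_cmul (int (n j)) (nu_chain C (xhat (l j)))"
    using n by (intro bexI[of _ j] frag_cmul_strict_mono nu_chain_xhat_outside C) auto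
qed (auto intro: frag_cmul_height_vec_le C)

lemma sum_height_vec_eq:
  assumes "maximal_chain C" "l ` {1..k} \<subseteq> C"
  shows "nu_chain C (xhat_monomial k l n) = (\<Sum>j=1..k. frag_cmul (int (n j)) (height_vec (l j)))"
  unfolding nu_chain_xhat_monomial[OF assms(1)]
proof (rule sum.cong[OF refl])
  fix j assume "j \<in> {1..k}"
  then show "frag_cmul (int (n j)) (nu_chain C (xhat (l j))) = frag_cmul (int (n j)) (height_vec (l j))"
    using nu_chain_xhat_chain[OF assms(1), of "l j"] assms(2) by (simp add: image_subset_iff)
qed

text \<open>Pairwise comparable indices lie together in some maximal chain, where the lower bound
  valid for all chains is attained.\<close>

lemma nu_ht_standard_monomial:
  assumes n: "\<forall>j\<in>{1..k}. n j \<noteq> 0" and std: "standard_indices k l"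
  shows "nu_ht (xhat_monomial k l n) = (\<Sum>j=1..k. frag_cmul (int (n j)) (height_vec (l j)))"
proof (rule antisym)
  obtain C where C: "maximal_chain C" "l ` {1..k} \<subseteq> C"
    by (rule maximal_chain_extend[of "l ` {1..k}"]) (use std in \<open>auto simp: standard_indices_def\<close>)
  then show "nu_ht (xhat_monomial k l n) \<le> (\<Sum>j=1..k. frag_cmul (int (n j)) (height_vec (l j)))"
    using nu_ht_le[OF C(1)] sum_height_vec_eq[OF C] by metis
next
  obtain C where C: "maximal_chain C" "nu_ht (xhat_monomial k l n) = nu_chain C (xhat_monomial k l n)"
    using nu_ht_attained by blast
  show "(\<Sum>j=1..k. frag_cmul (int (n j)) (height_vec (l j))) \<le> nu_ht (xhat_monomial k l n)"
    unfolding C(2) using sum_height_vec_less[OF C(1) n, of l] sum_height_vec_eq[OF C(1), of l k n]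
    by (cases "l ` {1..k} \<subseteq> C") auto
qed

theorem theorem5p3:
  fixes l :: "nat \<Rightarrow> 'a::{finite, distrib_lattice, bounded_lattice}"
    and n :: "nat \<Rightarrow> nat" and k :: nat
  assumes "\<forall>j\<in>{1..k}. n j \<noteq> 0"
  shows "(\<forall>C. maximal_chain C \<longrightarrow>
            nu_ht (xhat_monomial k l n) \<le> nu_chain C (xhat_monomial k l n) \<and>
            (standard_indices k l \<longrightarrow>
               nu_ht (xhat_monomial k l n) = nu_chain C (xhat_monomial k l n) \<longrightarrow>
               l ` {1..k} \<subseteq> C))
       \<and> (standard_indices k l \<longrightarrow>
            (\<forall>C. maximal_chain C \<and> l ` {1..k} \<subseteq> C \<longrightarrow>
               nu_ht (xhat_monomial k l n) =
                 (\<Sum>j=1..k. frag_cmul (int (n j)) (nu_ht (xhat (l j)))) \<and>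
               (\<Sum>j=1..k. frag_cmul (int (n j)) (nu_ht (xhat (l j)))) =
                 (\<Sum>j=1..k. frag_cmul (int (n j)) (nu_chain C (xhat (l j))))))
       \<and> (\<not> standard_indices k l \<longrightarrow>
            nu_ht (xhat_monomial k l n) >
              (\<Sum>j=1..k. frag_cmul (int (n j)) (nu_ht (xhat (l j)))))"
proof (intro conjI allI impI)
  fix C :: "'a set" assume C: "maximal_chain C"
  show "nu_ht (xhat_monomial k l n) \<le> nu_chain C (xhat_monomial k l n)"
    using C by (rule nu_ht_le)
  assume "standard_indices k l" "nu_ht (xhat_monomial k l n) = nu_chain C (xhat_monomial k l n)"
  \<comment> \<open>An index outside \<open>C\<close> would push the value under \<open>C\<close>
    strictly above the sum of height vectors, which is the value of \<open>nu_ht\<close>.\<close>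
  then show "l ` {1..k} \<subseteq> C"
    using nu_ht_standard_monomial[OF assms] sum_height_vec_less[OF C assms] by force
next
  fix C :: "'a set" assume "standard_indices k l"
  then show "nu_ht (xhat_monomial k l n) = (\<Sum>j=1..k. frag_cmul (int (n j)) (nu_ht (xhat (l j))))"
    using nu_ht_standard_monomial[OF assms] by (simp add: nu_ht_xhat)
next
  fix C :: "'a set" assume C: "maximal_chain C \<and> l ` {1..k} \<subseteq> C"
  \<comment> \<open>Both sums equal the value of the monomial under \<open>C\<close>.\<close>
  show "(\<Sum>j=1..k. frag_cmul (int (n j)) (nu_ht (xhat (l j)))) =
      (\<Sum>j=1..k. frag_cmul (int (n j)) (nu_chain C (xhat (l j))))"
    using C sum_height_vec_eq[of C l k n] nu_chain_xhat_monomial[of C k l n] by (simp add: nu_ht_xhat)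
next
  assume "\<not> standard_indices k l"
  \<comment> \<open>A chain attaining the minimum cannot contain two incomparable indices, so the
    strict bound applies to it.\<close>
  then obtain C where C: "maximal_chain C"
    "nu_ht (xhat_monomial k l n) = nu_chain C (xhat_monomial k l n)" "\<not> l ` {1..k} \<subseteq> C"
    using nonstandard_equality_outside_chain[of k l n] by blast
  show "(\<Sum>j=1..k. frag_cmul (int (n j)) (nu_ht (xhat (l j)))) < nu_ht (xhat_monomial k l n)"
    using sum_height_vec_less[OF C(1) assms C(3)] by (simp add: nu_ht_xhat C(2))
qed

end
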